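(* Consider $SO(N)$ lattice gauge theory on $\mathbb{Z}^2$ in the strong coupling regime $|\beta|<\beta_0$. Then for every plaquette $p$, $$w(p,\beta)=\lim_{N\to\infty}\frac{\langle W_p\rangle_{\Lambda_N,N,\beta}}{N}=\beta .$$
   Context: Model. $E$ is the set of directed nearest-neighbour edges of $\mathbb{Z}^2$; $e^{-1}$ is the reversal of $e$; $E^+$ is the set of positively oriented edges (ending point larger than starting point in the lexicographic order). A plaquette $p=e_1e_2e_3e_4$ is a closed walk of length four around a unit square (four distinct edges), identified up to cyclic permutation; it is positively oriented if its smallest and second smallest vertices (lexicographically) occur in that order. For finite $\Lambda\subset\mathbb{Z}^2$, $E_\Lambda^+$ is the set of edges of $E^+$ with both endpoints in $\Lambda$, and $\mathcal{P}_\Lambda^+$ is the set of positively oriented plaquettes with all edges in $\Lambda$. For $N\ge 1$, $\beta\in\mathbb{R}$, the Gibbs measure $\mu_{\Lambda,N,\beta}$ is the probability measure on configurations $Q=(Q_e)_{e\in E_\Lambda^+}\in SO(N)^{E_\Lambda^+}$ whose density with respect to product Haar probability measure is $Z_{\Lambda,N,\beta}^{-1}\exp\big(N\beta\sum_{p\in\mathcal{P}_\Lambda^+}\mathrm{Tr}(Q_p)\big)$, where $Q_{e^{-1}}=Q_e^{-1}$ and $Q_p=Q_{e_1}Q_{e_2}Q_{e_3}Q_{e_4}$. Expectation is denoted $\langle\cdot\rangle_{\Lambda,N,\beta}$. Loops. A loop $\ell=e_1\cdots e_n$ is a non-backtracking closed walk; $W_\ell=\mathrm{Tr}(Q_{e_1}\cdots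 Q_{e_n})$. Strong coupling regime. Fix finite sets $\Lambda_1\subset\Lambda_2\subset\cdots$ with union $\mathbb{Z}^2$. By a theorem of Chatterjee there is $\beta_0>0$ such that for $|\beta|<\beta_0$ and every loop $\ell$ the limit $w(\ell,\beta)=\lim_N\langle W_\ell\rangle_{\Lambda_N,N,\beta}/N$ exists (independently of the choice of $(\Lambda_N)$), normalized expectations of products of Wilson loop variables factorize as $N\to\infty$, and $w(\ell,\beta)=\sum_{k\ge0}a_k(\ell)\beta^k$ is an absolutely convergent power series. $\beta_0$ denotes such a constant. *)

theory Defs
  imports "HOL-Probability.Probability" "Jordan_Normal_Form.Determinant"
begin

type_synonym site = "int \<times> int"
type_synonym edge = "site \<times> site"

definition lex_less :: "site \<Rightarrow> site \<Rightarrow> bool" where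
  "lex_less u v \<longleftrightarrow> fst u < fst v \<or> fst u = fst v \<and> snd u < snd v"

definition lex_least :: "site set \<Rightarrow> site \<Rightarrow> bool" where
  "lex_least S u \<longleftrightarrow> u \<in> S \<and> (\<forall>v\<in>S - {u}. lex_less u v)"

definition edges :: "edge set" where
  "edges = {(u, v). \<bar>fst u - fst v\<bar> + \<bar>snd u - snd v\<bar> = 1}"

definition rev_edge :: "edge \<Rightarrow> edge" where
  "rev_edge e = (snd e, fst e)"

definition pos_edges :: "edge set" where
  "pos_edges = {e \<in> edges. lex_less (fst e) (snd e)}"

definition pos_edges_in :: "site set \<Rightarrow> edge set" where
  "pos_edges_in \<Lambda> = {e \<in> pos_edges. fst e \<in> \<Lambda> \<and> snd e \<in> \<Lambda>}"

definition closed_walk :: "edge list \<Rightarrow> bool" where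
  "closed_walk es \<longleftrightarrow> es \<noteq> [] \<and> set es \<subseteq> edges \<and>
     (\<forall>i<length es. snd (es ! i) = fst (es ! (Suc i mod length es)))"

text \<open>Backtracking is understood cyclically: the last edge of a loop may not be the
  reversal of the first one either.\<close>

definition is_loop :: "edge list \<Rightarrow> bool" where
  "is_loop es \<longleftrightarrow> closed_walk es \<and>
     (\<forall>i<length es. es ! (Suc i mod length es) \<noteq> rev_edge (es ! i))"

definition sites :: "edge list \<Rightarrow> site set" where
  "sites es = set (map fst es)"

definition plaquette :: "edge list \<Rightarrow> bool" where
  "plaquette es \<longleftrightarrow> closed_walk es \<and> length es = 4 \<and> distinct es \<and>
     (\<exists>x y. sites es = {(x, y), (x + 1, y), (x + 1, y + 1), (x, y + 1)})"

text \<open>The walk visits the second smallest vertex of its square right after the smallest one.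
  This does not depend on the starting point of the walk.\<close>

definition positively_oriented :: "edge list \<Rightarrow> bool" where
  "positively_oriented es \<longleftrightarrow>
     (\<exists>(u, v)\<in>set es. lex_least (sites es) u \<and> lex_least (sites es - {u}) v)"

text \<open>Plaquettes are identified up to cyclic permutation. In the set below each positively
  oriented plaquette is represented once, by the walk that starts at its smallest vertex
  (see \<open>plaquette_representative\<close>).\<close>

definition pos_plaquettes_in :: "site set \<Rightarrow> edge list set" where
  "pos_plaquettes_in \<Lambda> = {es. plaquette es \<and> positively_oriented es \<and>
     lex_least (sites es) (fst (hd es)) \<and> (\<forall>e\<in>set es. fst e \<in> \<Lambda> \<and> snd e \<in> \<Lambda>)}"

lemma plaquette_representative:
  assumes "plaquette es"
  shows "\<exists>!es'. (\<exists>k. es' = rotate k es) \<and> lex_least (sites es') (fst (hd es'))"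
proof -
  from assms obtain x y where len: "length es = 4"
    and S: "sites es = {(x, y), (x + 1, y), (x + 1, y + 1), (x, y + 1)}"
    unfolding plaquette_def by blast
  have "card (set (map fst es)) = length (map fst es)"
    using S len by (simp add: sites_def)
  then have dist: "distinct (map fst es)" by (rule card_distinct)
  have rot: "sites (rotate k es) = sites es" for k
    by (simp add: sites_def)
  have least: "lex_least (sites es) u \<longleftrightarrow> u = (x, y)" for u
  proof
    assume "lex_least (sites es) u"
    then have "u \<in> sites es" "(x, y) \<noteq> u \<longrightarrow> lex_less u (x, y)"
      unfolding lex_least_def S by blast+
    then show "u = (x, y)"
      unfolding S by (auto simp: lex_less_def)
  qed (auto simp: S lex_least_def lex_less_def)
  have hd_rot: "hd (rotate k es) = es ! (k mod 4)" for k
    using len by (subst hd_rotate_conv_nth) auto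
  have "(x, y) \<in> set (map fst es)" using S by (simp add: sites_def)
  then obtain i where i: "i < 4" "fst (es ! i) = (x, y)"
    using len by (auto simp: in_set_conv_nth)
  show ?thesis
  proof (rule ex1I[of _ "rotate i es"])
    show "(\<exists>k. rotate i es = rotate k es) \<and> lex_least (sites (rotate i es)) (fst (hd (rotate i es)))"
      using i by (auto simp: rot least hd_rot)
  next
    fix es' assume "(\<exists>k. es' = rotate k es) \<and> lex_least (sites es') (fst (hd es'))"
    then obtain k where k: "es' = rotate k es" "fst (es ! (k mod 4)) = (x, y)"
      by (auto simp: rot least hd_rot)
    have "k mod 4 = i"
      using nth_eq_iff_index_eq[OF dist, of "k mod 4" i] i k(2) len by simp
    then show "es' = rotate i es"
      using k(1) len by (metis rotate_conv_mod)
  qed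
qed

definition exhausting :: "(nat \<Rightarrow> site set) \<Rightarrow> bool" where
  "exhausting \<Lambda> \<longleftrightarrow> (\<forall>N\<ge>1. finite (\<Lambda> N) \<and> \<Lambda> N \<subseteq> \<Lambda> (Suc N)) \<and> (\<Union>N\<in>{1..}. \<Lambda> N) = UNIV"


definition SO :: "nat \<Rightarrow> real mat monoid" where
  "SO N = \<lparr>carrier = {A \<in> carrier_mat N N. transpose_mat A * A = 1\<^sub>m N \<and> Determinant.det A = 1},
           monoid.mult = (*), one = 1\<^sub>m N\<rparr>"

lemma SO_group: "group (SO N)"
proof (rule groupI)
  fix A B assume "A \<in> carrier (SO N)" "B \<in> carrier (SO N)"
  then have A: "A \<in> carrier_mat N N" "transpose_mat A * A = 1\<^sub>m N" "Determinant.det A = 1"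
    and B: "B \<in> carrier_mat N N" "transpose_mat B * B = 1\<^sub>m N" "Determinant.det B = 1"
    by (auto simp: SO_def)
  have "transpose_mat (A * B) * (A * B) = transpose_mat B * (transpose_mat A * A) * B"
    using A(1) B(1)
    by (simp add: transpose_mult[OF A(1) B(1)] assoc_mult_mat[of _ N N _ N _ N])
  then have "transpose_mat (A * B) * (A * B) = 1\<^sub>m N"
    using A B by simp
  then show "A \<otimes>\<^bsub>SO N\<^esub> B \<in> carrier (SO N)"
    using A B by (auto simp: SO_def Determinant.det_mult[OF A(1) B(1)])
next
  show "\<one>\<^bsub>SO N\<^esub> \<in> carrier (SO N)" by (simp add: SO_def)
next
  fix A B C assume "A \<in> carrier (SO N)" "B \<in> carrier (SO N)" "C \<in> carrier (SO N)"
  then show "A \<otimes>\<^bsub>SO N\<^esub> B \<otimes>\<^bsub>SO N\<^esub> C = A \<otimes>\<^bsub>SO N\<^esub> (B \<otimes>\<^bsub>SO N\<^esub> C)"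
    by (auto simp: SO_def intro!: assoc_mult_mat[of _ N N _ N _ N])
next
  fix A assume "A \<in> carrier (SO N)"
  then show "\<one>\<^bsub>SO N\<^esub> \<otimes>\<^bsub>SO N\<^esub> A = A" by (auto simp: SO_def)
next
  fix A assume "A \<in> carrier (SO N)"
  then have A: "A \<in> carrier_mat N N" "transpose_mat A * A = 1\<^sub>m N" "Determinant.det A = 1"
    by (auto simp: SO_def)
  then have "A * transpose_mat A = 1\<^sub>m N"
    by (intro mat_mult_left_right_inverse[of "transpose_mat A" N A]) auto
  then have "transpose_mat A \<in> carrier (SO N)"
    using A by (simp add: SO_def Determinant.det_transpose[OF A(1)])
  then show "\<exists>B\<in>carrier (SO N). B \<otimes>\<^bsub>SO N\<^esub> A = \<one>\<^bsub>SO N\<^esub>"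
    using A by (intro bexI[of _ "transpose_mat A"]) (auto simp: SO_def)
qed

text \<open>The Borel sets of \<open>SO(N)\<close> as a subspace of the space of real \<open>N \<times> N\<close> arrays.\<close>

definition SO_borel :: "nat \<Rightarrow> real mat measure" where
  "SO_borel N = vimage_algebra (carrier (SO N))
     (\<lambda>A. \<lambda>ij\<in>{..<N} \<times> {..<N}. A $$ ij) (Pi\<^sub>M ({..<N} \<times> {..<N}) (\<lambda>_. borel))"

text \<open>These conditions determine \<open>M\<close> uniquely.\<close>

definition haar_SO :: "nat \<Rightarrow> real mat measure \<Rightarrow> bool" where
  "haar_SO N M \<longleftrightarrow> prob_space M \<and> sets M = sets (SO_borel N) \<and>
     (\<forall>A\<in>carrier (SO N). distr M M (\<lambda>B. A \<otimes>\<^bsub>SO N\<^esub> B) = M)"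


definition mat_trace :: "real mat \<Rightarrow> real" where
  "mat_trace A = (\<Sum>i<dim_row A. A $$ (i, i))"

type_synonym config = "edge \<Rightarrow> real mat"

definition edge_matrix :: "nat \<Rightarrow> config \<Rightarrow> edge \<Rightarrow> real mat" where
  "edge_matrix N Q e = (if e \<in> pos_edges then Q e else inv\<^bsub>SO N\<^esub> (Q (rev_edge e)))"

definition path_matrix :: "nat \<Rightarrow> config \<Rightarrow> edge list \<Rightarrow> real mat" where
  "path_matrix N Q es = foldr (\<lambda>e A. edge_matrix N Q e \<otimes>\<^bsub>SO N\<^esub> A) es \<one>\<^bsub>SO N\<^esub>"

definition wilson :: "nat \<Rightarrow> edge list \<Rightarrow> config \<Rightarrow> real" where
  "wilson N es Q = mat_trace (path_matrix N Q es)"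

text \<open>In the following \<open>H N\<close> stands for the Haar probability measure on \<open>SO(N)\<close>.\<close>

definition gibbs_weight :: "site set \<Rightarrow> nat \<Rightarrow> real \<Rightarrow> config \<Rightarrow> real" where
  "gibbs_weight \<Lambda> N \<beta> Q = exp (real N * \<beta> * (\<Sum>p\<in>pos_plaquettes_in \<Lambda>. wilson N p Q))"

definition product_haar :: "(nat \<Rightarrow> real mat measure) \<Rightarrow> site set \<Rightarrow> nat \<Rightarrow> config measure" where
  "product_haar H \<Lambda> N = Pi\<^sub>M (pos_edges_in \<Lambda>) (\<lambda>_. H N)"

definition partition_function ::
    "(nat \<Rightarrow> real mat measure) \<Rightarrow> site set \<Rightarrow> nat \<Rightarrow> real \<Rightarrow> real" where
  "partition_function H \<Lambda> N \<beta> = (\<integral>Q. gibbs_weight \<Lambda> N \<beta> Q \<partial>product_haar H \<Lambda> N)"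

definition gibbs ::
    "(nat \<Rightarrow> real mat measure) \<Rightarrow> site set \<Rightarrow> nat \<Rightarrow> real \<Rightarrow> config measure" where
  "gibbs H \<Lambda> N \<beta> = density (product_haar H \<Lambda> N)
     (\<lambda>Q. ennreal (gibbs_weight \<Lambda> N \<beta> Q / partition_function H \<Lambda> N \<beta>))"

text \<open>A walk that leaves \<open>\<Lambda>\<close> gets a junk value here. In the limits below this affects only
  finitely many \<open>N\<close>.\<close>

definition expect ::
    "(nat \<Rightarrow> real mat measure) \<Rightarrow> site set \<Rightarrow> nat \<Rightarrow> real \<Rightarrow> (config \<Rightarrow> real) \<Rightarrow> real" where
  "expect H \<Lambda> N \<beta> F = (\<integral>Q. F Q \<partial>gibbs H \<Lambda> N \<beta>)"


definition wilson_limit ::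
    "(nat \<Rightarrow> real mat measure) \<Rightarrow> (nat \<Rightarrow> site set) \<Rightarrow> edge list \<Rightarrow> real \<Rightarrow> real" where
  "wilson_limit H \<Lambda> l \<beta> = lim (\<lambda>N. expect H (\<Lambda> N) N \<beta> (wilson N l) / real N)"

text \<open>The properties of \<open>\<beta>\<^sub>0\<close> supplied by Chatterjee's theorem.\<close>

definition strong_coupling :: "(nat \<Rightarrow> real mat measure) \<Rightarrow> real \<Rightarrow> bool" where
  "strong_coupling H \<beta>\<^sub>0 \<longleftrightarrow> \<beta>\<^sub>0 > 0 \<and>
     (\<forall>\<beta> \<Lambda> l. \<bar>\<beta>\<bar> < \<beta>\<^sub>0 \<longrightarrow> exhausting \<Lambda> \<longrightarrow> is_loop l \<longrightarrow>
        convergent (\<lambda>N. expect H (\<Lambda> N) N \<beta> (wilson N l) / real N)) \<and>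
     (\<forall>\<beta> \<Lambda> \<Lambda>' l. \<bar>\<beta>\<bar> < \<beta>\<^sub>0 \<longrightarrow> exhausting \<Lambda> \<longrightarrow> exhausting \<Lambda>' \<longrightarrow> is_loop l \<longrightarrow>
        wilson_limit H \<Lambda> l \<beta> = wilson_limit H \<Lambda>' l \<beta>) \<and>
     (\<forall>\<beta> \<Lambda> ls. \<bar>\<beta>\<bar> < \<beta>\<^sub>0 \<longrightarrow> exhausting \<Lambda> \<longrightarrow> (\<forall>l\<in>set ls. is_loop l) \<longrightarrow>
        (\<lambda>N. expect H (\<Lambda> N) N \<beta> (\<lambda>Q. \<Prod>l\<leftarrow>ls. wilson N l Q) / real N ^ length ls)
          \<longlonglongrightarrow> (\<Prod>l\<leftarrow>ls. wilson_limit H \<Lambda> l \<beta>)) \<and>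
     (\<forall>l. is_loop l \<longrightarrow> (\<exists>a::nat \<Rightarrow> real. \<forall>\<beta> \<Lambda>. \<bar>\<beta>\<bar> < \<beta>\<^sub>0 \<longrightarrow> exhausting \<Lambda> \<longrightarrow>
        summable (\<lambda>k. \<bar>a k * \<beta> ^ k\<bar>) \<and> wilson_limit H \<Lambda> l \<beta> = (\<Sum>k. a k * \<beta> ^ k)))"

end

theory Submission
  imports Defs "HOL-Complex_Analysis.Cauchy_Integral_Formula"
begin

text \<open>By independence of the exhaustion it suffices to work on centered boxes. There, for a square
  \<open>p\<close>, take the vertical edges of its row from the left side of \<open>p\<close> to the boundary of the box and
  multiply them by \<open>A \<in> SO(N)\<close>, transported along the horizontal edges below. This preserves the
  product Haar measure, turns \<open>Q\<^sub>p\<close> into \<open>A Q\<^sub>p\<close> and conjugates or fixes all other plaquette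
  variables, so up to the weight of \<open>p\<close> itself the law of \<open>Q\<^sub>p\<close> is left invariant. Differentiating along plane
  rotations gives the loop equations of a one-matrix model; divided by \<open>N\<^sup>2\<close> and with
  factorization they become, for the limits \<open>w\<^sub>k\<close> of the loops \<open>p\<^sup>k\<close> and \<open>w\<^sub>0 = 1\<close>, the recursion
  \<open>(\<Sum>m<k. w\<^sub>m w\<^sub>k\<^sub>-\<^sub>m) = \<beta> (w\<^sub>k\<^sub>-\<^sub>1 - w\<^sub>k\<^sub>+\<^sub>1)\<close>. Among convergent power series in \<open>\<beta>\<close> its only
  solution is \<open>w\<^sub>1 = \<beta>\<close> and \<open>w\<^sub>k = 0\<close> for \<open>k \<ge> 2\<close>.\<close>

section \<open>The recursion for power series\<close>

text \<open>The equation for \<open>w\<^sub>1\<close> contains \<open>w\<^sub>2\<close>, so all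
  powers of the loop have to be carried along. Even then, at a fixed \<beta> other than 0, the
  hierarchy leaves \<open>w\<^sub>1\<close> free and merely expresses the later moments through it.
  What singles out one solution is that each \<open>w\<^sub>k\<close> is a power series on a common
  interval around 0. The moments 1, \<beta>, 0, 0, ... found in this way are those of the density
  \<open>1 + 2 \<beta> cos t\<close> on the circle, with respect to normalized arc length. The shift
  has to run to the boundary because moving one vertical edge of \<open>p\<close> also disturbs the
  plaquette on its other side. Moving the next vertical edge along repairs that plaquette and passes
  the defect on, until the last edge of the row has no plaquette beyond it. This relies on dimension
  two, where an edge borders at most two plaquettes, and on the free boundary of the box. The powers
  of N balance: a product of two traces has size \<open>N\<^sup>2\<close>, and so has the term from
  differentiating the weight, where the factor \<open>N \<beta>\<close> multiplies a single
  trace.\<close>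

lemma power_series_eq_0:
  fixes a :: "nat \<Rightarrow> real"
  assumes "r > 0" "\<And>x. \<bar>x\<bar> < r \<Longrightarrow> (\<lambda>n. a n * x ^ n) sums 0"
  shows "a = (\<lambda>_. 0)"
proof (rule ccontr)
  assume "a \<noteq> (\<lambda>_. 0)"
  then obtain m where m: "a m \<noteq> 0" by auto
  have "(\<lambda>n. a n * 0 ^ n) sums a 0" by (rule powser_sums_zero)
  with assms(2)[of 0] assms(1) have "a 0 = 0" using sums_unique2 by fastforce
  with m have "m > 0" by (cases m) auto
  \<comment> \<open>With a nonzero coefficient, 0 is an isolated zero of the sum. As the sum is
    constantly 0, this says that 0 differs from 0 at the point \<open>s\<close>.\<close>
  obtain s where s: "0 < s" "\<And>z::real. z \<in> cball 0 s - {0} \<Longrightarrow> (0::real) \<noteq> 0"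
    by (rule powser_0_nonzero[of r 0 a "\<lambda>_. 0" m]) (use assms m \<open>m > 0\<close> in auto)
  have "s \<in> cball 0 s - {0}" using s by auto
  with s(2) show False by blast
qed

text \<open>Absolute convergence is included so that products can be formed by Cauchy
  multiplication. Identities between functions on the interval then become identities in the ring
  \<open>real fps\<close>, where coefficients can be compared.\<close>

definition fps_represents :: "real \<Rightarrow> real fps \<Rightarrow> (real \<Rightarrow> real) \<Rightarrow> bool" where
  "fps_represents r F w \<longleftrightarrow> (\<forall>x. \<bar>x\<bar> < r \<longrightarrow>
     summable (\<lambda>n. \<bar>fps_nth F n * x ^ n\<bar>) \<and> (\<lambda>n. fps_nth F n * x ^ n) sums w x)"

lemma fps_represents_1: "fps_represents r 1 (\<lambda>_. 1)"
proof -
  have *: "fps_nth 1 n * x ^ n = (if n = 0 then 1 else 0)" for n and x :: real by simp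
  show ?thesis
    unfolding fps_represents_def * using sums_single[of 0 "\<lambda>_. 1::real"]
    by (auto intro: summable_finite[of "{0}"])
qed

lemma fps_represents_X: "fps_represents r fps_X (\<lambda>x. x)"
proof -
  have *: "fps_nth fps_X n * x ^ n = (if n = 1 then x else 0)" for n and x :: real by simp
  show ?thesis
    unfolding fps_represents_def * using sums_single[of 1 "\<lambda>_. _::real"]
    by (intro allI impI conjI summable_finite[of "{1}"]) auto
qed

lemma fps_represents_diff:
  assumes "fps_represents r F f" "fps_represents r G g"
  shows "fps_represents r (F - G) (\<lambda>x. f x - g x)"
  unfolding fps_represents_def
proof (intro allI impI conjI)
  fix x :: real assume x: "\<bar>x\<bar> < r"
  show "(\<lambda>n. fps_nth (F - G) n * x ^ n) sums (f x - g x)"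
    using assms x by (simp add: fps_represents_def algebra_simps sums_diff)
  show "summable (\<lambda>n. \<bar>fps_nth (F - G) n * x ^ n\<bar>)"
  proof (rule summable_comparison_test)
    show "summable (\<lambda>n. \<bar>fps_nth F n * x ^ n\<bar> + \<bar>fps_nth G n * x ^ n\<bar>)"
      using assms x by (auto simp: fps_represents_def intro: summable_add)
    show "\<exists>N. \<forall>n\<ge>N. norm \<bar>fps_nth (F - G) n * x ^ n\<bar> \<le> \<bar>fps_nth F n * x ^ n\<bar> + \<bar>fps_nth G n * x ^ n\<bar>"
      by (auto simp: left_diff_distrib simp del: abs_mult)
  qed
qed

lemma fps_represents_mult:
  assumes "fps_represents r F f" "fps_represents r G g"
  shows "fps_represents r (F * G) (\<lambda>x. f x * g x)"
  unfolding fps_represents_def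
proof (intro allI impI conjI)
  fix x :: real assume x: "\<bar>x\<bar> < r"
  define a b where "a = (\<lambda>n. fps_nth F n * x ^ n)" and "b = (\<lambda>n. fps_nth G n * x ^ n)"
  have a: "summable (\<lambda>n. \<bar>a n\<bar>)" "a sums f x" and b: "summable (\<lambda>n. \<bar>b n\<bar>)" "b sums g x"
    using assms x by (auto simp: fps_represents_def a_def b_def)
  have c: "fps_nth (F * G) n * x ^ n = (\<Sum>i\<le>n. a i * b (n - i))" for n
  proof -
    have "fps_nth (F * G) n * x ^ n = (\<Sum>i\<le>n. fps_nth F i * fps_nth G (n - i) * x ^ (i + (n - i)))"
      by (simp add: fps_mult_nth atLeast0AtMost sum_distrib_right)
    also have "\<dots> = (\<Sum>i\<le>n. a i * b (n - i))"
      unfolding a_def b_def by (intro sum.cong refl) (simp only: power_add ac_simps)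
    finally show ?thesis .
  qed
  show "(\<lambda>n. fps_nth (F * G) n * x ^ n) sums (f x * g x)"
    using Cauchy_product_sums[of a b] a b by (simp add: c sums_iff)
  have "summable (\<lambda>n. \<Sum>i\<le>n. \<bar>a i\<bar> * \<bar>b (n - i)\<bar>)"
    using summable_Cauchy_product[of "\<lambda>n. \<bar>a n\<bar>" "\<lambda>n. \<bar>b n\<bar>"] a b by simp
  then show "summable (\<lambda>n. \<bar>fps_nth (F * G) n * x ^ n\<bar>)"
    by (rule summable_comparison_test[rotated])
      (auto simp: c abs_mult[symmetric] simp del: abs_mult intro!: exI[of _ 0] order_trans[OF sum_abs])
qed

lemma fps_represents_sum:
  assumes "finite A" "\<And>i. i \<in> A \<Longrightarrow> fps_represents r (F i) (f i)"
  shows "fps_represents r (\<Sum>i\<in>A. F i) (\<lambda>x. \<Sum>i\<in>A. f i x)"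
  using assms
proof (induction A rule: finite_induct)
  case empty
  show ?case using fps_represents_diff[OF fps_represents_1 fps_represents_1, of r] by simp
next
  case (insert i A)
  \<comment> \<open>Addition is obtained from subtraction as \<open>f - (0 - g)\<close>, with 0
    written as \<open>1 - 1\<close>.\<close>
  have "fps_represents r (F i - (1 - 1 - (\<Sum>i\<in>A. F i))) (\<lambda>x. f i x - (1 - 1 - (\<Sum>i\<in>A. f i x)))"
    by (intro fps_represents_diff fps_represents_1 insert) auto
  with insert show ?case by (simp add: algebra_simps)
qed

lemma fps_represents_unique:
  assumes "r > 0" "fps_represents r F f" "fps_represents r G g" "\<And>x. \<bar>x\<bar> < r \<Longrightarrow> f x = g x"
  shows "F = G"
proof -
  have "(\<lambda>n. fps_nth (F - G) n * x ^ n) sums 0" if "\<bar>x\<bar> < r" for x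
    using fps_represents_diff[OF assms(2,3)] that assms(4) by (auto simp: fps_represents_def)
  then have "fps_nth (F - G) = (\<lambda>_. 0)"
    by (intro power_series_eq_0[OF assms(1)])
  then show ?thesis by (auto simp: fps_eq_iff fun_eq_iff)
qed

text \<open>The terms of order \<open>m\<close> of the products involve only coefficients of order below \<open>m\<close>, because
  the constant terms vanish. Hence the double induction on \<open>m\<close> and \<open>k\<close>.\<close>

lemma fps_loop_recursion_coeff:
  fixes F :: "nat \<Rightarrow> real fps"
  assumes F0: "F 0 = 1"
    and rec: "\<And>k. k \<ge> 1 \<Longrightarrow> (\<Sum>j<k. F j * F (k - j)) = fps_X * (F (k - 1) - F (k + 1))"
  shows "k \<ge> 1 \<Longrightarrow> fps_nth (F k) m = (if k = 1 \<and> m = 1 then 1 else 0)"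
proof (induction m arbitrary: k rule: less_induct)
  case (less m)
  note IHm = less.IH
  show ?case using less.prems
  proof (induction k rule: less_induct)
    case (less k)
    have "(\<Sum>j<k. F j * F (k - j)) = F k + (\<Sum>j\<in>{1..<k}. F j * F (k - j))"
      using less.prems F0 by (simp add: lessThan_atLeast0 sum.atLeast_Suc_lessThan)
    with rec[OF less.prems]
    have "F k = fps_X * (F (k - 1) - F (k + 1)) - (\<Sum>j\<in>{1..<k}. F j * F (k - j))"
      by (simp add: algebra_simps)
    then have eq: "fps_nth (F k) m = (if m = 0 then 0 else fps_nth (F (k - 1)) (m - 1) - fps_nth (F (k + 1)) (m - 1))
        - (\<Sum>j\<in>{1..<k}. \<Sum>i\<le>m. fps_nth (F j) i * fps_nth (F (k - j)) (m - i))"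
      by (auto simp: fps_sum_nth fps_X_mult_nth fps_mult_nth[of "F _" "F _"] atLeast0AtMost)
    \<comment> \<open>The only contribution of the products is the square of the linear term of
      \<open>F 1\<close>. It occurs for \<open>k = 2\<close>, \<open>m = 2\<close> and is cancelled
      below by the linear term of \<open>F 1\<close> in \<open>fps_X * F (k - 1)\<close>.\<close>
    have "(\<Sum>i\<le>m. fps_nth (F j) i * fps_nth (F (k - j)) (m - i)) = (if k = 2 \<and> m = 2 then 1 else 0)"
      if j: "j \<in> {1..<k}" for j
    proof -
      \<comment> \<open>For \<open>m = 0\<close> this is the inner induction, as both
        \<open>j\<close> and \<open>k - j\<close> are below \<open>k\<close>; for positive
        \<open>m\<close> it is the outer one.\<close>
      have z: "fps_nth (F j) 0 = 0" "fps_nth (F (k - j)) 0 = 0"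
        using j IHm[of 0 j] IHm[of 0 "k - j"] less.IH[of j] less.IH[of "k - j"] by (cases "m = 0"; force)+
      have "fps_nth (F j) i * fps_nth (F (k - j)) (m - i)
          = (if i = 1 then if k = 2 \<and> m = 2 then 1 else 0 else 0)" if "i \<in> {..m}" for i
      proof (cases "i = 0 \<or> i = m")
        case True
        then show ?thesis using z by auto
      next
        case False
        then have "0 < i" "i < m" using that by auto
        then show ?thesis using IHm[of i j] IHm[of "m - i" "k - j"] j by (cases "i = 1") auto
      qed
      then have "(\<Sum>i\<le>m. fps_nth (F j) i * fps_nth (F (k - j)) (m - i))
          = (\<Sum>i\<le>m. if i = 1 then if k = 2 \<and> m = 2 then 1 else 0 else 0)"
        by (intro sum.cong) auto
      then show ?thesis by simp
    qed
    then have "(\<Sum>j\<in>{1..<k}. \<Sum>i\<le>m. fps_nth (F j) i * fps_nth (F (k - j)) (m - i))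
        = (\<Sum>j\<in>{1..<k}. if k = 2 \<and> m = 2 then 1 else 0)" by (intro sum.cong) auto
    also have "\<dots> = (if k = 2 \<and> m = 2 then 1 else 0)" by auto
    finally have s: "(\<Sum>j\<in>{1..<k}. \<Sum>i\<le>m. fps_nth (F j) i * fps_nth (F (k - j)) (m - i))
        = (if k = 2 \<and> m = 2 then 1 else 0)" .
    show ?case
    proof (cases "m = 0")
      case True
      then show ?thesis using eq s by simp
    next
      case False
      have "fps_nth (F (k + 1)) (m - 1) = 0" using IHm[of "m - 1" "k + 1"] False less.prems by simp
      \<comment> \<open>The case \<open>k = 1\<close> comes from \<open>F 0 = 1\<close> and produces
        the asserted coefficient; the case \<open>k = 2\<close> comes from the linear term of
        \<open>F 1\<close>.\<close>
      moreover have "fps_nth (F (k - 1)) (m - 1) = (if k = 1 \<and> m = 1 \<or> k = 2 \<and> m = 2 then 1 else 0)"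
      proof (cases "k = 1")
        case True
        then show ?thesis using F0 False by auto
      next
        case k: False
        then show ?thesis using IHm[of "m - 1" "k - 1"] False less.prems by auto
      qed
      ultimately show ?thesis using eq s False by auto
    qed
  qed
qed

lemma loop_recursion_solution:
  fixes w :: "nat \<Rightarrow> real \<Rightarrow> real"
  assumes r: "r > 0"
    and w0: "\<And>x. w 0 x = 1"
    and w: "\<And>k. k \<ge> 1 \<Longrightarrow> \<exists>F. fps_represents r F (w k)"
    and rec: "\<And>k x. k \<ge> 1 \<Longrightarrow> \<bar>x\<bar> < r \<Longrightarrow>
        (\<Sum>j<k. w j x * w (k - j) x) = x * (w (k - 1) x - w (k + 1) x)"
    and x: "\<bar>x\<bar> < r"
  shows "w 1 x = x"
proof -
  obtain G where G: "\<And>k. k \<ge> 1 \<Longrightarrow> fps_represents r (G k) (w k)" using w by metis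
  define F where "F k = (if k = 0 then 1 else G k)" for k
  have F: "fps_represents r (F k) (w k)" for k
  proof (cases "k = 0")
    case True
    have "w 0 = (\<lambda>_. 1)" using w0 by auto
    with True show ?thesis using fps_represents_1 by (simp add: F_def)
  qed (use G in \<open>simp add: F_def\<close>)
  have "(\<Sum>j<k. F j * F (k - j)) = fps_X * (F (k - 1) - F (k + 1))" if "k \<ge> 1" for k
  proof (rule fps_represents_unique[OF r])
    show "fps_represents r (\<Sum>j<k. F j * F (k - j)) (\<lambda>x. \<Sum>j<k. w j x * w (k - j) x)"
      by (intro fps_represents_sum fps_represents_mult F) auto
    show "fps_represents r (fps_X * (F (k - 1) - F (k + 1))) (\<lambda>x. x * (w (k - 1) x - w (k + 1) x))"
      by (intro fps_represents_mult fps_represents_diff fps_represents_X F)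
  qed (use rec that in auto)
  then have "fps_nth (F 1) m = fps_nth fps_X m" for m
    using fps_loop_recursion_coeff[of F 1 m] by (auto simp: F_def)
  then have "F 1 = fps_X" by (simp add: fps_eq_iff)
  then have "(\<lambda>n. fps_nth fps_X n * x ^ n) sums w 1 x" using F[of 1] x by (simp add: fps_represents_def)
  moreover have "(\<lambda>n. fps_nth fps_X n * x ^ n) sums x"
    using fps_represents_X[of r] x by (simp add: fps_represents_def)
  ultimately show ?thesis by (rule sums_unique2)
qed

section \<open>The special orthogonal group\<close>

lemma SO_simps [simp]:
  "A \<otimes>\<^bsub>SO N\<^esub> B = A * B" "\<one>\<^bsub>SO N\<^esub> = 1\<^sub>m N"
  by (simp_all add: SO_def)

lemma SO_D:
  assumes "A \<in> carrier (SO N)"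
  shows "A \<in> carrier_mat N N" "transpose_mat A * A = 1\<^sub>m N" "A * transpose_mat A = 1\<^sub>m N"
    "Determinant.det A = 1" "dim_row A = N" "dim_col A = N"
proof -
  show *: "A \<in> carrier_mat N N" "transpose_mat A * A = 1\<^sub>m N" "Determinant.det A = 1"
    using assms by (auto simp: SO_def)
  then show "dim_row A = N" "dim_col A = N" by auto
  show "A * transpose_mat A = 1\<^sub>m N"
    using * by (intro mat_mult_left_right_inverse[of "transpose_mat A" N A]) auto
qed

lemma SO_mult_closed: "A \<in> carrier (SO N) \<Longrightarrow> B \<in> carrier (SO N) \<Longrightarrow> A * B \<in> carrier (SO N)"
  using monoid.m_closed[OF group.is_monoid[OF SO_group], of A N B] by simp

lemma SO_one_closed: "1\<^sub>m N \<in> carrier (SO N)"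
  using monoid.one_closed[OF group.is_monoid[OF SO_group], of N] by simp

lemma SO_transpose_closed:
  assumes "A \<in> carrier (SO N)"
  shows "transpose_mat A \<in> carrier (SO N)"
  using SO_D[OF assms] by (simp add: SO_def Determinant.det_transpose)

lemma SO_pow_closed:
  assumes "A \<in> carrier (SO N)"
  shows "A ^\<^sub>m k \<in> carrier (SO N)"
  using assms SO_D(5)[OF assms] by (induction k) (simp_all add: SO_one_closed SO_mult_closed)

lemma SO_inv:
  assumes "A \<in> carrier (SO N)"
  shows "inv\<^bsub>SO N\<^esub> A = transpose_mat A"
  using group.inv_equality[OF SO_group, of N "transpose_mat A" A] assms
  by (simp add: SO_D(2) SO_transpose_closed)

lemma transpose_mult_cancel:
  assumes "A \<in> carrier (SO N)" "B \<in> carrier_mat N n"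
  shows "transpose_mat A * (A * B) = B" "A * (transpose_mat A * B) = B"
proof -
  note A = SO_D[OF assms(1)]
  show "transpose_mat A * (A * B) = B"
    using A assms(2) by (subst assoc_mult_mat[symmetric, of _ N N _ N _ n]) auto
  show "A * (transpose_mat A * B) = B"
    using A assms(2) by (subst assoc_mult_mat[symmetric, of _ N N _ N _ n]) auto
qed

lemma SO_entry_bound:
  assumes A: "A \<in> carrier (SO N)" and ij: "i < N" "j < N"
  shows "\<bar>A $$ (i, j)\<bar> \<le> 1"
proof -
  have "(transpose_mat A * A) $$ (j, j) = 1" using SO_D[OF A] ij by simp
  then have "(\<Sum>k<N. A $$ (k, j) * A $$ (k, j)) = 1"
    using SO_D(5,6)[OF A] ij by (simp add: scalar_prod_def lessThan_atLeast0)
  moreover have "A $$ (i, j) * A $$ (i, j) \<le> (\<Sum>k<N. A $$ (k, j) * A $$ (k, j))"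
    using ij by (intro member_le_sum) auto
  ultimately have "(A $$ (i, j))\<^sup>2 \<le> 1" by (simp add: power2_eq_square)
  then show ?thesis by (simp add: abs_square_le_1)
qed

lemma mat_trace_bound:
  assumes A: "A \<in> carrier (SO N)"
  shows "\<bar>mat_trace A\<bar> \<le> real N"
proof -
  have "\<bar>mat_trace A\<bar> \<le> (\<Sum>i<N. \<bar>A $$ (i, i)\<bar>)"
    using SO_D[OF A] by (simp add: mat_trace_def)
  also have "\<dots> \<le> (\<Sum>i<N. 1)" using A by (intro sum_mono SO_entry_bound) auto
  finally show ?thesis by simp
qed

lemma mat_mult_entry:
  assumes "A \<in> carrier_mat N m" "B \<in> carrier_mat m n" "i < N" "j < n"
  shows "(A * B) $$ (i, j) = (\<Sum>k<m. A $$ (i, k) * B $$ (k, j))"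
  using assms by (simp add: scalar_prod_def lessThan_atLeast0)

lemma mat_trace_mult:
  assumes "A \<in> carrier_mat N N" "B \<in> carrier_mat N N"
  shows "mat_trace (A * B) = (\<Sum>i<N. \<Sum>j<N. A $$ (i, j) * B $$ (j, i))"
  using assms by (simp add: mat_trace_def mat_mult_entry[OF assms] del: index_mult_mat(1))

lemma mat_trace_comm:
  assumes "A \<in> carrier_mat N N" "B \<in> carrier_mat N N"
  shows "mat_trace (A * B) = mat_trace (B * A)"
  unfolding mat_trace_mult[OF assms] mat_trace_mult[OF assms(2,1)]
  by (subst sum.swap) (simp add: mult.commute)

lemma mat_trace_transpose:
  assumes "A \<in> carrier_mat N N"
  shows "mat_trace (transpose_mat A) = mat_trace A"
  using assms by (simp add: mat_trace_def)

lemma mat_trace_conj: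
  assumes A: "A \<in> carrier (SO N)" and B: "B \<in> carrier_mat N N"
  shows "mat_trace (A * B * transpose_mat A) = mat_trace B"
proof -
  note A' = SO_D[OF A]
  have "mat_trace (A * B * transpose_mat A) = mat_trace (transpose_mat A * (A * B))"
    using A' B by (intro mat_trace_comm) auto
  then show ?thesis using transpose_mult_cancel[OF A B] by simp
qed

section \<open>Measurable maps into SO(N), checked entry by entry\<close>

lemma space_SO_borel [simp]: "space (SO_borel N) = carrier (SO N)"
  by (simp add: SO_borel_def)

lemma entry_measurable [measurable]:
  assumes "i < N" "j < N"
  shows "(\<lambda>A. A $$ (i, j)) \<in> borel_measurable (SO_borel N)"
proof -
  let ?f = "\<lambda>A. \<lambda>ij\<in>{..<N} \<times> {..<N}. A $$ ij"
  have 1: "?f \<in> SO_borel N \<rightarrow>\<^sub>M (Pi\<^sub>M ({..<N} \<times> {..<N}) (\<lambda>_. borel))"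
    unfolding SO_borel_def by (rule measurable_vimage_algebra1) (auto simp: space_PiM)
  have "(\<lambda>A. ?f A (i, j)) \<in> borel_measurable (SO_borel N)"
    by (rule measurable_compose[OF 1 measurable_component_singleton]) (use assms in auto)
  then show ?thesis using assms by simp
qed

lemma measurable_SO_borelI:
  assumes "\<And>x. x \<in> space M \<Longrightarrow> f x \<in> carrier (SO N)"
    and "\<And>i j. i < N \<Longrightarrow> j < N \<Longrightarrow> (\<lambda>x. f x $$ (i, j)) \<in> borel_measurable M"
  shows "f \<in> M \<rightarrow>\<^sub>M SO_borel N"
  unfolding SO_borel_def
proof (rule measurable_vimage_algebra2)
  show "f \<in> space M \<rightarrow> carrier (SO N)" using assms(1) by auto
  show "(\<lambda>x. \<lambda>ij\<in>{..<N} \<times> {..<N}. f x $$ ij) \<in> M \<rightarrow>\<^sub>M (Pi\<^sub>M ({..<N} \<times> {..<N}) (\<lambda>_. borel))"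
    by (rule measurable_restrict) (use assms(2) in auto)
qed

lemma measurable_SO_mult [measurable (raw)]:
  assumes f: "f \<in> M \<rightarrow>\<^sub>M SO_borel N" and g: "g \<in> M \<rightarrow>\<^sub>M SO_borel N"
  shows "(\<lambda>x. f x * g x) \<in> M \<rightarrow>\<^sub>M SO_borel N"
proof (rule measurable_SO_borelI)
  note sp = measurable_space[OF f] measurable_space[OF g]
  show "f x * g x \<in> carrier (SO N)" if "x \<in> space M" for x
    using sp that by (simp add: SO_mult_closed)
  fix i j assume ij: "i < N" "j < N"
  have "(\<lambda>x. \<Sum>k<N. f x $$ (i, k) * g x $$ (k, j)) \<in> borel_measurable M"
    using measurable_compose[OF f entry_measurable] measurable_compose[OF g entry_measurable] ij
    by (intro borel_measurable_sum borel_measurable_times) auto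
  moreover have "(f x * g x) $$ (i, j) = (\<Sum>k<N. f x $$ (i, k) * g x $$ (k, j))" if "x \<in> space M" for x
    using sp that ij by (intro mat_mult_entry[of _ N N _ N] SO_D(1)) auto
  ultimately show "(\<lambda>x. (f x * g x) $$ (i, j)) \<in> borel_measurable M"
    by (subst measurable_cong)
qed

lemma measurable_SO_transpose [measurable (raw)]:
  assumes f: "f \<in> M \<rightarrow>\<^sub>M SO_borel N"
  shows "(\<lambda>x. transpose_mat (f x)) \<in> M \<rightarrow>\<^sub>M SO_borel N"
proof (rule measurable_SO_borelI)
  note sp = measurable_space[OF f]
  show "transpose_mat (f x) \<in> carrier (SO N)" if "x \<in> space M" for x
    using sp that by (simp add: SO_transpose_closed)
  fix i j assume ij: "i < N" "j < N"
  have "(\<lambda>x. f x $$ (j, i)) \<in> borel_measurable M"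
    using measurable_compose[OF f entry_measurable] ij by auto
  moreover have "transpose_mat (f x) $$ (i, j) = f x $$ (j, i)" if "x \<in> space M" for x
    using SO_D(5,6)[of "f x" N] sp that ij by simp
  ultimately show "(\<lambda>x. transpose_mat (f x) $$ (i, j)) \<in> borel_measurable M"
    by (subst measurable_cong)
qed

lemma measurable_SO_pow [measurable (raw)]:
  assumes f: "f \<in> M \<rightarrow>\<^sub>M SO_borel N"
  shows "(\<lambda>x. f x ^\<^sub>m k) \<in> M \<rightarrow>\<^sub>M SO_borel N"
proof (induction k)
  case 0
  have "(\<lambda>x. 1\<^sub>m N) \<in> M \<rightarrow>\<^sub>M SO_borel N" by (simp add: SO_one_closed)
  \<comment> \<open>The power 0 is an identity matrix of the size of \<open>f x\<close>, so it is
    known to be constant only on the space of \<open>M\<close>.\<close>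
  moreover have "f x ^\<^sub>m 0 = 1\<^sub>m N" if "x \<in> space M" for x
    using SO_D(5)[of "f x" N] measurable_space[OF f that] by simp
  ultimately show ?case
    by (subst measurable_cong)
qed (use f in \<open>simp add: measurable_SO_mult\<close>)

lemma measurable_mat_trace [measurable (raw)]:
  assumes f: "f \<in> M \<rightarrow>\<^sub>M SO_borel N"
  shows "(\<lambda>x. mat_trace (f x)) \<in> borel_measurable M"
proof -
  have "(\<lambda>x. \<Sum>i<N. f x $$ (i, i)) \<in> borel_measurable M"
    using measurable_compose[OF f entry_measurable] by (intro borel_measurable_sum) auto
  moreover have "mat_trace (f x) = (\<Sum>i<N. f x $$ (i, i))" if "x \<in> space M" for x
    using SO_D(5)[of "f x" N] measurable_space[OF f that] by (simp add: mat_trace_def)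
  ultimately show ?thesis
    by (subst measurable_cong)
qed

section \<open>Plane rotations and integration by parts\<close>

text \<open>The one-parameter group generated by the antisymmetric matrix with entry 1 at
  \<open>(i, j)\<close> and -1 at \<open>(j, i)\<close>. These generators span the tangent space of
  SO(N) at the identity. For \<open>i = j\<close> the formula does not give a rotation, whence the
  assumption \<open>i \<noteq> j\<close> throughout.\<close>

definition plane_rotation :: "nat \<Rightarrow> nat \<Rightarrow> nat \<Rightarrow> real \<Rightarrow> real mat" where
  "plane_rotation N i j t = mat N N (\<lambda>(a, b).
     if a = i then (if b = i then cos t else if b = j then sin t else 0)
     else if a = j then (if b = j then cos t else if b = i then - sin t else 0)
     else if a = b then 1 else 0)"

lemma plane_rotation_carrier [simp]: "plane_rotation N i j t \<in> carrier_mat N N"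
  and dim_plane_rotation [simp]: "dim_row (plane_rotation N i j t) = N" "dim_col (plane_rotation N i j t) = N"
  by (simp_all add: plane_rotation_def)

lemma plane_rotation_mult_entry:
  assumes ij: "i < N" "j < N" "i \<noteq> j" and M: "M \<in> carrier_mat N n" and ab: "a < N" "b < n"
  shows "(plane_rotation N i j t * M) $$ (a, b) =
    (if a = i then cos t * M $$ (i, b) + sin t * M $$ (j, b)
     else if a = j then cos t * M $$ (j, b) - sin t * M $$ (i, b) else M $$ (a, b))"
proof -
  have "(plane_rotation N i j t * M) $$ (a, b) = (\<Sum>c<N. plane_rotation N i j t $$ (a, c) * M $$ (c, b))"
    by (rule mat_mult_entry[OF _ M ab]) simp
  also have "\<dots> = (\<Sum>c<N. (if c = i then plane_rotation N i j t $$ (a, i) * M $$ (i, b) else 0) +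
       (if c = j then plane_rotation N i j t $$ (a, j) * M $$ (j, b) else 0) +
       (if c = a \<and> a \<noteq> i \<and> a \<noteq> j then M $$ (a, b) else 0))"
    using ij ab by (intro sum.cong refl) (auto simp: plane_rotation_def)
  also have "\<dots> = plane_rotation N i j t $$ (a, i) * M $$ (i, b) + plane_rotation N i j t $$ (a, j) * M $$ (j, b)
       + (if a \<noteq> i \<and> a \<noteq> j then M $$ (a, b) else 0)"
    using ij ab by (cases "a \<noteq> i \<and> a \<noteq> j") (auto simp: sum.distrib)
  finally show ?thesis using ij ab by (auto simp: plane_rotation_def)
qed

lemma plane_rotation_add:
  assumes ij: "i < N" "j < N" "i \<noteq> j"
  shows "plane_rotation N i j s * plane_rotation N i j t = plane_rotation N i j (s + t)"
proof (rule eq_matI)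
  fix a b assume "a < dim_row (plane_rotation N i j (s + t))" "b < dim_col (plane_rotation N i j (s + t))"
  then have ab: "a < N" "b < N" by simp_all
  show "(plane_rotation N i j s * plane_rotation N i j t) $$ (a, b) = plane_rotation N i j (s + t) $$ (a, b)"
    unfolding plane_rotation_mult_entry[OF ij plane_rotation_carrier ab]
    using ij ab by (auto simp: plane_rotation_def cos_add sin_add)
qed simp_all

lemma plane_rotation_0: "plane_rotation N i j 0 = 1\<^sub>m N"
  by (rule eq_matI) (auto simp: plane_rotation_def)

lemma plane_rotation_transpose: "transpose_mat (plane_rotation N i j t) = plane_rotation N i j (- t)"
  if "i \<noteq> j"
  by (rule eq_matI) (use that in \<open>auto simp: plane_rotation_def\<close>)

lemma plane_rotation_SO:
  assumes ij: "i < N" "j < N" "i \<noteq> j"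
  shows "plane_rotation N i j t \<in> carrier (SO N)"
proof -
  let ?R = "plane_rotation N i j"
  have orth: "transpose_mat (?R s) * ?R s = 1\<^sub>m N" for s
    using ij by (simp add: plane_rotation_transpose plane_rotation_add plane_rotation_0)
  \<comment> \<open>Orthogonality alone leaves the sign of the determinant open. A rotation is the
    square of the rotation by half the angle, so its determinant is the square of a number with
    square 1, read off from orthogonality at \<open>t/2\<close>.\<close>
  have "Determinant.det (transpose_mat (?R (t/2)) * ?R (t/2)) = 1" by (simp add: orth)
  then have "Determinant.det (?R (t/2)) * Determinant.det (?R (t/2)) = 1"
    by (simp add: Determinant.det_mult[of _ N] Determinant.det_transpose[of _ N])
  moreover have "?R t = ?R (t/2) * ?R (t/2)" using ij by (simp add: plane_rotation_add)
  ultimately have "Determinant.det (?R t) = 1"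
    by (simp add: Determinant.det_mult[of _ N])
  then show ?thesis using orth by (simp add: SO_def)
qed

text \<open>Write Y for the rotated matrix and X for the generator. The derivative of Y is X Y, and
  by the product rule the derivative of the k-th power is the sum of \<open>Y^m X Y^(k-m)\<close>
  over \<open>m < k\<close>. Since X has only two nonzero entries, each summand becomes a difference
  of two products of entries.\<close>

lemma plane_rotation_pow_deriv:
  assumes ij: "i < N" "j < N" "i \<noteq> j" and Q: "Q \<in> carrier_mat N N"
  shows "a < N \<Longrightarrow> b < N \<Longrightarrow>
    ((\<lambda>s. ((plane_rotation N i j s * Q) ^\<^sub>m k) $$ (a, b)) has_real_derivative
     (\<Sum>m<k. ((plane_rotation N i j t * Q) ^\<^sub>m m) $$ (a, i) * ((plane_rotation N i j t * Q) ^\<^sub>m (k - m)) $$ (j, b)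
       - ((plane_rotation N i j t * Q) ^\<^sub>m m) $$ (a, j) * ((plane_rotation N i j t * Q) ^\<^sub>m (k - m)) $$ (i, b))) (at t)"
proof (induction k arbitrary: a b)
  case 0
  then show ?case using Q by simp
next
  case (Suc k)
  let ?Y = "\<lambda>s. plane_rotation N i j s * Q"
  have Y: "?Y s ^\<^sub>m m \<in> carrier_mat N N" for s m
    using Q by (intro pow_carrier_mat mult_carrier_mat[of _ N N]) auto
  have Y1: "?Y s \<in> carrier_mat N N" for s
    using Q by (intro mult_carrier_mat[of _ N N]) auto
  have mult: "(?Y s ^\<^sub>m Suc m) $$ (a, b) = (\<Sum>c<N. (?Y s ^\<^sub>m m) $$ (a, c) * ?Y s $$ (c, b))"
    if "a < N" "b < N" for s m a b
    using mat_mult_entry[OF Y Y1 that] by simp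
  have dY: "((\<lambda>s. ?Y s $$ (c, b)) has_real_derivative
      (if c = i then ?Y t $$ (j, b) else if c = j then - ?Y t $$ (i, b) else 0)) (at t)" if "c < N" for c
    using ij that Suc.prems unfolding plane_rotation_mult_entry[OF ij Q that Suc.prems(2)]
      plane_rotation_mult_entry[OF ij Q ij(1) Suc.prems(2)] plane_rotation_mult_entry[OF ij Q ij(2) Suc.prems(2)]
    by (auto intro!: derivative_eq_intros)
  let ?D = "\<lambda>k a b. \<Sum>m<k. (?Y t ^\<^sub>m m) $$ (a, i) * (?Y t ^\<^sub>m (k - m)) $$ (j, b)
       - (?Y t ^\<^sub>m m) $$ (a, j) * (?Y t ^\<^sub>m (k - m)) $$ (i, b)"
  let ?y = "\<lambda>c. if c = i then ?Y t $$ (j, b) else if c = j then - ?Y t $$ (i, b) else 0"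
  have "((\<lambda>s. \<Sum>c<N. (?Y s ^\<^sub>m k) $$ (a, c) * ?Y s $$ (c, b)) has_real_derivative
     (\<Sum>c<N. ?D k a c * ?Y t $$ (c, b) + ?y c * (?Y t ^\<^sub>m k) $$ (a, c))) (at t)"
    using Suc by (intro DERIV_sum DERIV_mult dY) auto
  also have "(\<Sum>c<N. ?D k a c * ?Y t $$ (c, b) + ?y c * (?Y t ^\<^sub>m k) $$ (a, c))
      = (\<Sum>c<N. ?D k a c * ?Y t $$ (c, b)) + (\<Sum>c<N. ?y c * (?Y t ^\<^sub>m k) $$ (a, c))"
    by (rule sum.distrib)
  also have "(\<Sum>c<N. ?y c * (?Y t ^\<^sub>m k) $$ (a, c)) =
      (\<Sum>c<N. (if c = i then ?Y t $$ (j, b) * (?Y t ^\<^sub>m k) $$ (a, i) else 0)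
        + (if c = j then - ?Y t $$ (i, b) * (?Y t ^\<^sub>m k) $$ (a, j) else 0))"
    using ij by (intro sum.cong) auto
  also have "\<dots> = (?Y t ^\<^sub>m k) $$ (a, i) * ?Y t $$ (j, b) - (?Y t ^\<^sub>m k) $$ (a, j) * ?Y t $$ (i, b)"
    using ij by (simp add: sum.distrib)
  also have "(\<Sum>c<N. ?D k a c * ?Y t $$ (c, b)) = (\<Sum>m<k. \<Sum>c<N. ((?Y t ^\<^sub>m m) $$ (a, i) * (?Y t ^\<^sub>m (k - m)) $$ (j, c)
       - (?Y t ^\<^sub>m m) $$ (a, j) * (?Y t ^\<^sub>m (k - m)) $$ (i, c)) * ?Y t $$ (c, b))"
    unfolding sum_distrib_right by (rule sum.swap)
  also have "\<dots> = (\<Sum>m<k. (?Y t ^\<^sub>m m) $$ (a, i) * (?Y t ^\<^sub>m (Suc k - m)) $$ (j, b)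
       - (?Y t ^\<^sub>m m) $$ (a, j) * (?Y t ^\<^sub>m (Suc k - m)) $$ (i, b))"
  proof (intro sum.cong refl)
    fix m assume "m \<in> {..<k}"
    then have "Suc k - m = Suc (k - m)" by auto
    then show "(\<Sum>c<N. ((?Y t ^\<^sub>m m) $$ (a, i) * (?Y t ^\<^sub>m (k - m)) $$ (j, c)
       - (?Y t ^\<^sub>m m) $$ (a, j) * (?Y t ^\<^sub>m (k - m)) $$ (i, c)) * ?Y t $$ (c, b)) =
      (?Y t ^\<^sub>m m) $$ (a, i) * (?Y t ^\<^sub>m (Suc k - m)) $$ (j, b)
       - (?Y t ^\<^sub>m m) $$ (a, j) * (?Y t ^\<^sub>m (Suc k - m)) $$ (i, b)"
      using ij Suc.prems
      by (simp only: mult left_diff_distrib sum_subtractf sum_distrib_left mult.assoc)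
  qed
  also have "\<dots> + ((?Y t ^\<^sub>m k) $$ (a, i) * ?Y t $$ (j, b) - (?Y t ^\<^sub>m k) $$ (a, j) * ?Y t $$ (i, b)) = ?D (Suc k) a b"
    using Y1[of t] Q by simp
  finally show ?case by (simp only: mult[OF Suc.prems])
qed

text \<open>By invariance the difference quotients with steps \<open>1 / (n + 1)\<close> integrate
  to 0 against \<open>W\<close>. They are bounded by \<open>C\<close>, so dominated convergence
  passes this on to the derivative.\<close>

lemma integral_rotation_derivative:
  fixes W :: "'a \<Rightarrow> real" and g dg :: "real mat \<Rightarrow> real"
  assumes W: "integrable M W"
    and Y: "Y \<in> M \<rightarrow>\<^sub>M SO_borel N"
    and g: "g \<in> borel_measurable (SO_borel N)" "\<And>Q. Q \<in> carrier (SO N) \<Longrightarrow> \<bar>g Q\<bar> \<le> B"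
    and dg: "dg \<in> borel_measurable (SO_borel N)" "\<And>Q. Q \<in> carrier (SO N) \<Longrightarrow> \<bar>dg Q\<bar> \<le> C"
    and R: "\<And>t. R t \<in> carrier (SO N)" "R 0 = 1\<^sub>m N"
    and inv: "\<And>t. (\<integral>x. g (R t * Y x) * W x \<partial>M) = (\<integral>x. g (Y x) * W x \<partial>M)"
    and deriv: "\<And>Q t. Q \<in> carrier (SO N) \<Longrightarrow> ((\<lambda>s. g (R s * Q)) has_real_derivative dg (R t * Q)) (at t)"
  shows "(\<integral>x. dg (Y x) * W x \<partial>M) = 0"
proof -
  note Ysp = measurable_space[OF Y, simplified]
  have RY: "(\<lambda>x. R t * Y x) \<in> M \<rightarrow>\<^sub>M SO_borel N" for t
    by (intro measurable_SO_mult Y) (simp add: R)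
  have gint: "integrable M (\<lambda>x. g (Z x) * W x)" if Z: "Z \<in> M \<rightarrow>\<^sub>M SO_borel N" for Z
  proof (rule Bochner_Integration.integrable_bound)
    show "integrable M (\<lambda>x. B * W x)" using W by simp
    show "(\<lambda>x. g (Z x) * W x) \<in> borel_measurable M"
      using measurable_compose[OF Z g(1)] borel_measurable_integrable[OF W] by simp
    show "AE x in M. norm (g (Z x) * W x) \<le> norm (B * W x)"
    proof (rule AE_I2)
      fix x assume "x \<in> space M"
      then have "\<bar>g (Z x)\<bar> \<le> B" using g(2) measurable_space[OF Z] by simp
      then show "norm (g (Z x) * W x) \<le> norm (B * W x)"
        by (auto simp: abs_mult intro!: mult_right_mono)
    qed
  qed
  define s where "s n x = (g (R (1 / real (Suc n)) * Y x) - g (Y x)) * real (Suc n) * W x" for n x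
  have s_eq: "s n = (\<lambda>x. real (Suc n) * (g (R (1 / real (Suc n)) * Y x) * W x - g (Y x) * W x))" for n
    unfolding s_def by (auto simp: algebra_simps)
  have s0: "(\<integral>x. s n x \<partial>M) = 0" for n
    unfolding s_eq by (simp add: Bochner_Integration.integral_diff[OF gint[OF RY] gint[OF Y]] inv del: of_nat_Suc)
  have "(\<lambda>n. \<integral>x. s n x \<partial>M) \<longlonglongrightarrow> (\<integral>x. dg (Y x) * W x \<partial>M)"
  proof (rule integral_dominated_convergence)
    show "(\<lambda>x. dg (Y x) * W x) \<in> borel_measurable M"
      using measurable_compose[OF Y dg(1)] borel_measurable_integrable[OF W] by simp
    show "s n \<in> borel_measurable M" for n
      unfolding s_eq using gint[OF RY] gint[OF Y] by (intro borel_measurable_integrable) auto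
    show "integrable M (\<lambda>x. C * \<bar>W x\<bar>)" using W by simp
    show "AE x in M. (\<lambda>n. s n x) \<longlonglongrightarrow> dg (Y x) * W x"
    proof (rule AE_I2)
      fix x assume x: "x \<in> space M"
      have "((\<lambda>h. (g (R h * Y x) - g (Y x)) / h) \<longlongrightarrow> dg (Y x)) (at 0)"
        using deriv[OF Ysp[OF x], of 0] SO_D(1)[OF Ysp[OF x]] R(2) by (simp add: DERIV_def)
      moreover have "filterlim (\<lambda>n. 1 / real (Suc n)) (at 0) sequentially"
        using LIMSEQ_inverse_real_of_nat by (auto simp: filterlim_at inverse_eq_divide)
      ultimately have "(\<lambda>n. (g (R (1 / real (Suc n)) * Y x) - g (Y x)) / (1 / real (Suc n))) \<longlonglongrightarrow> dg (Y x)"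
        by (rule filterlim_compose)
      then have "(\<lambda>n. (g (R (1 / real (Suc n)) * Y x) - g (Y x)) / (1 / real (Suc n)) * W x) \<longlonglongrightarrow> dg (Y x) * W x"
        by (rule tendsto_mult_right)
      then show "(\<lambda>n. s n x) \<longlonglongrightarrow> dg (Y x) * W x"
        by (simp add: s_def del: of_nat_Suc)
    qed
    show "AE x in M. norm (s n x) \<le> C * \<bar>W x\<bar>" for n
    proof (rule AE_I2)
      fix x assume x: "x \<in> space M"
      let ?h = "1 / real (Suc n)"
      \<comment> \<open>By the mean value theorem the quotient is a value of \<open>dg\<close> at
        another point of SO(N), where the bound \<open>C\<close> applies again.\<close>
      have "\<exists>z>0. z < ?h \<and> g (R ?h * Y x) - g (R 0 * Y x) = (?h - 0) * dg (R z * Y x)"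
        using deriv[OF Ysp[OF x]] by (intro MVT2) auto
      then obtain z where "g (R ?h * Y x) - g (Y x) = ?h * dg (R z * Y x)"
        using SO_D(1)[OF Ysp[OF x]] R(2) by auto
      then have "s n x = dg (R z * Y x) * W x" by (simp add: s_def del: of_nat_Suc)
      moreover have "\<bar>dg (R z * Y x)\<bar> \<le> C"
        using dg(2) R(1) Ysp[OF x] by (simp add: SO_mult_closed)
      ultimately show "norm (s n x) \<le> C * \<bar>W x\<bar>" by (simp add: abs_mult mult_right_mono)
    qed
  qed
  then show ?thesis using s0 by (simp add: LIMSEQ_const_iff)
qed

section \<open>Summing the derivatives over all coordinate planes\<close>

lemma exp_trace_bound:
  assumes "Q \<in> carrier (SO N)"
  shows "exp (c * mat_trace Q) \<le> exp (\<bar>c\<bar> * real N)"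
proof -
  have "c * mat_trace Q \<le> \<bar>c\<bar> * \<bar>mat_trace Q\<bar>" by (metis abs_ge_self abs_mult)
  also have "\<dots> \<le> \<bar>c\<bar> * real N" using mat_trace_bound[OF assms] by (intro mult_left_mono) auto
  finally show ?thesis by simp
qed

text \<open>The case \<open>k = 1\<close> of the derivative of powers, summed over the diagonal: the
  trace of the generator times the rotated matrix.\<close>

lemma mat_trace_rotation_deriv:
  assumes ij: "i < N" "j < N" "i \<noteq> j" and Q: "Q \<in> carrier_mat N N"
  shows "((\<lambda>s. mat_trace (plane_rotation N i j s * Q)) has_real_derivative
     (plane_rotation N i j t * Q) $$ (j, i) - (plane_rotation N i j t * Q) $$ (i, j)) (at t)"
proof -
  let ?Y = "\<lambda>s. plane_rotation N i j s * Q"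
  have Y: "?Y s \<in> carrier_mat N N" for s
    using Q by (intro mult_carrier_mat[of _ N N]) auto
  have p: "?Y s ^\<^sub>m 1 = ?Y s" "?Y s ^\<^sub>m 0 = 1\<^sub>m N" for s
    using Q by auto
  have d: "((\<lambda>s. ?Y s $$ (a, a)) has_real_derivative
      (if a = i then ?Y t $$ (j, a) else 0) - (if a = j then ?Y t $$ (i, a) else 0)) (at t)" if "a < N" for a
    using plane_rotation_pow_deriv[OF ij Q that that, of 1 t, unfolded p] ij that p
    by (cases "a = i"; cases "a = j") simp_all
  have "((\<lambda>s. \<Sum>a<N. ?Y s $$ (a, a)) has_real_derivative
      (\<Sum>a<N. (if a = i then ?Y t $$ (j, a) else 0) - (if a = j then ?Y t $$ (i, a) else 0))) (at t)"
    by (intro DERIV_sum d) auto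
  then show ?thesis using ij by (simp add: mat_trace_def sum_subtractf)
qed

lemma sum_pair_entries:
  fixes A B :: "real mat"
  assumes "A \<in> carrier_mat N N" "B \<in> carrier_mat N N"
  shows "(\<Sum>i<N. \<Sum>j<N. A $$ (j, i) * B $$ (j, i)) = mat_trace (transpose_mat A * B)"
    "(\<Sum>i<N. \<Sum>j<N. A $$ (i, j) * B $$ (i, j)) = mat_trace (transpose_mat A * B)"
    "(\<Sum>i<N. \<Sum>j<N. A $$ (j, i) * B $$ (i, j)) = mat_trace (A * B)"
    "(\<Sum>i<N. \<Sum>j<N. A $$ (i, j) * B $$ (j, i)) = mat_trace (A * B)"
    "(\<Sum>i<N. \<Sum>j<N. A $$ (j, j) * B $$ (i, i)) = mat_trace A * mat_trace B"
    "(\<Sum>i<N. \<Sum>j<N. A $$ (i, i) * B $$ (j, j)) = mat_trace A * mat_trace B"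
proof -
  have t: "transpose_mat A $$ (i, j) = A $$ (j, i)" if "i < N" "j < N" for i j
    using assms that by simp
  have "mat_trace (transpose_mat A * B) = (\<Sum>i<N. \<Sum>j<N. transpose_mat A $$ (i, j) * B $$ (j, i))"
    using assms by (intro mat_trace_mult) auto
  also have "\<dots> = (\<Sum>i<N. \<Sum>j<N. A $$ (j, i) * B $$ (j, i))" by (intro sum.cong) (auto simp: t)
  finally show 1: "(\<Sum>i<N. \<Sum>j<N. A $$ (j, i) * B $$ (j, i)) = mat_trace (transpose_mat A * B)" ..
  show "(\<Sum>i<N. \<Sum>j<N. A $$ (i, j) * B $$ (i, j)) = mat_trace (transpose_mat A * B)"
    unfolding 1[symmetric] by (rule sum.swap)
  show 3: "(\<Sum>i<N. \<Sum>j<N. A $$ (i, j) * B $$ (j, i)) = mat_trace (A * B)"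
    using mat_trace_mult[OF assms] by simp
  show "(\<Sum>i<N. \<Sum>j<N. A $$ (j, i) * B $$ (i, j)) = mat_trace (A * B)"
    unfolding 3[symmetric] by (rule sum.swap)
  show 5: "(\<Sum>i<N. \<Sum>j<N. A $$ (i, i) * B $$ (j, j)) = mat_trace A * mat_trace B"
    using assms by (simp add: mat_trace_def sum_product)
  show "(\<Sum>i<N. \<Sum>j<N. A $$ (j, j) * B $$ (i, i)) = mat_trace A * mat_trace B"
    unfolding 5[symmetric] by (rule sum.swap)
qed

text \<open>For each pair \<open>i\<close>, \<open>j\<close> differentiate the function \<open>g i j\<close> of the proof along the rotations of the
  \<open>i\<close>-\<open>j\<close> plane. The sum of the derivatives over all pairs is an expression in traces.\<close>

lemma loop_equation_of_invariance:
  fixes W :: "'a \<Rightarrow> real"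
  assumes W: "integrable M W"
    and Y: "Y \<in> M \<rightarrow>\<^sub>M SO_borel N"
    and inv: "\<And>A g B. A \<in> carrier (SO N) \<Longrightarrow> g \<in> borel_measurable (SO_borel N) \<Longrightarrow>
       (\<And>Q. Q \<in> carrier (SO N) \<Longrightarrow> \<bar>g Q\<bar> \<le> B) \<Longrightarrow>
       (\<integral>x. g (A * Y x) * W x \<partial>M) = (\<integral>x. g (Y x) * W x \<partial>M)"
    and k: "k \<ge> 1"
  shows "(\<integral>x. ((\<Sum>m<k. mat_trace (transpose_mat (Y x ^\<^sub>m m) * Y x ^\<^sub>m (k - m))
        - mat_trace (Y x ^\<^sub>m m) * mat_trace (Y x ^\<^sub>m (k - m)))
      + c * (mat_trace (Y x ^\<^sub>m (k - 1)) - mat_trace (Y x ^\<^sub>m (k + 1)))) * exp (c * mat_trace (Y x)) * W x \<partial>M) = 0"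
proof -
  \<comment> \<open>The first factor is the trace of the (i, j) generator times
    \<open>Q ^\<^sub>m k\<close>. The exponential is kept inside the test function because
    invariance is available only for \<open>W\<close>, which lacks it.\<close>
  define g where "g i j Q = ((Q ^\<^sub>m k) $$ (j, i) - (Q ^\<^sub>m k) $$ (i, j)) * exp (c * mat_trace Q)" for i j Q
  define d where "d i j a b Q = (\<Sum>m<k. (Q ^\<^sub>m m) $$ (a, i) * (Q ^\<^sub>m (k - m)) $$ (j, b)
      - (Q ^\<^sub>m m) $$ (a, j) * (Q ^\<^sub>m (k - m)) $$ (i, b))" for i j a b and Q :: "real mat"
  define dg where "dg i j Q = (d i j j i Q - d i j i j Q
      + c * (((Q ^\<^sub>m k) $$ (j, i) - (Q ^\<^sub>m k) $$ (i, j)) * (Q $$ (j, i) - Q $$ (i, j)))) * exp (c * mat_trace Q)" for i j Q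
  have me: "(\<lambda>Q. (Q ^\<^sub>m m) $$ (a, b)) \<in> borel_measurable (SO_borel N)" if "a < N" "b < N" for m a b
    by (rule measurable_compose[OF measurable_SO_pow entry_measurable]) (use that in auto)
  have mt: "(\<lambda>Q. mat_trace Q) \<in> borel_measurable (SO_borel N)"
    by (rule measurable_mat_trace[where N = N]) simp
  have eb: "\<bar>(Q ^\<^sub>m m) $$ (a, b)\<bar> \<le> 1" if "Q \<in> carrier (SO N)" "a < N" "b < N" for Q m a b
    using that by (intro SO_entry_bound SO_pow_closed)
  have eb2: "\<bar>x * y - x' * y'\<bar> \<le> 2" if "\<bar>x\<bar> \<le> 1" "\<bar>y\<bar> \<le> 1" "\<bar>x'\<bar> \<le> 1" "\<bar>y'\<bar> \<le> 1" for x y x' y' :: real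
    using mult_mono[of "\<bar>x\<bar>" 1 "\<bar>y\<bar>" 1] mult_mono[of "\<bar>x'\<bar>" 1 "\<bar>y'\<bar>" 1] that
    unfolding abs_mult[symmetric] by auto
  let ?E = "exp (\<bar>c\<bar> * real N)"
  have gm: "g i j \<in> borel_measurable (SO_borel N)" if "i < N" "j < N" for i j
    unfolding g_def using me mt that by measurable
  have gb: "\<bar>g i j Q\<bar> \<le> 2 * ?E" if "i < N" "j < N" "Q \<in> carrier (SO N)" for i j Q
    unfolding g_def abs_mult using that eb[of Q i j k] eb[of Q j i k] exp_trace_bound[of Q N c]
    by (intro mult_mono) auto
  have dgm: "dg i j \<in> borel_measurable (SO_borel N)" if "i < N" "j < N" for i j
    unfolding dg_def d_def using me mt entry_measurable that by measurable
  have db: "\<bar>d i j a b Q\<bar> \<le> 2 * real k" if "i < N" "j < N" "a < N" "b < N" "Q \<in> carrier (SO N)" for i j a b Q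
  proof -
    have "\<bar>d i j a b Q\<bar> \<le> (\<Sum>m<k. \<bar>(Q ^\<^sub>m m) $$ (a, i) * (Q ^\<^sub>m (k - m)) $$ (j, b)
      - (Q ^\<^sub>m m) $$ (a, j) * (Q ^\<^sub>m (k - m)) $$ (i, b)\<bar>)" unfolding d_def by (rule sum_abs)
    also have "\<dots> \<le> (\<Sum>m<k. 2)" using that by (intro sum_mono eb2 eb)
    finally show ?thesis by simp
  qed
  have dgb: "\<bar>dg i j Q\<bar> \<le> (4 * real k + \<bar>c\<bar> * (2 * 2)) * ?E" if "i < N" "j < N" "Q \<in> carrier (SO N)" for i j Q
  proof -
    have "\<bar>((Q ^\<^sub>m k) $$ (j, i) - (Q ^\<^sub>m k) $$ (i, j)) * (Q $$ (j, i) - Q $$ (i, j))\<bar> \<le> 2 * 2"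
      unfolding abs_mult using that eb[of Q i j k] eb[of Q j i k] SO_entry_bound[of Q N i j] SO_entry_bound[of Q N j i]
      by (intro mult_mono) auto
    then have "\<bar>c * (((Q ^\<^sub>m k) $$ (j, i) - (Q ^\<^sub>m k) $$ (i, j)) * (Q $$ (j, i) - Q $$ (i, j)))\<bar> \<le> \<bar>c\<bar> * (2 * 2)"
      unfolding abs_mult[of c] by (intro mult_left_mono) auto
    then show ?thesis
      unfolding dg_def abs_mult[of _ "exp _"] using that db[of i j j i Q] db[of i j i j Q] exp_trace_bound[of Q N c]
      by (intro mult_mono) auto
  qed
  have zero: "(\<integral>x. dg i j (Y x) * W x \<partial>M) = 0" if ij: "i < N" "j < N" for i j
  proof (cases "i = j")
    case True
    \<comment> \<open>Pairs with \<open>i = j\<close> belong to no rotation but contribute nothing,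
      so the sum may run over all ordered pairs.\<close>
    have "dg i j Q = 0" for Q by (simp add: dg_def True)
    then show ?thesis by simp
  next
    case False
    show ?thesis
    proof (rule integral_rotation_derivative[OF W Y gm[OF ij] gb[OF ij] dgm[OF ij] dgb[OF ij]])
      show "plane_rotation N i j t \<in> carrier (SO N)" for t
        by (rule plane_rotation_SO[OF ij False])
      then show "(\<integral>x. g i j (plane_rotation N i j t * Y x) * W x \<partial>M) = (\<integral>x. g i j (Y x) * W x \<partial>M)" for t
        by (rule inv[OF _ gm[OF ij] gb[OF ij]])
      show "plane_rotation N i j 0 = 1\<^sub>m N" by (rule plane_rotation_0)
      fix Q t assume "Q \<in> carrier (SO N)"
      then have Q: "Q \<in> carrier_mat N N" by (rule SO_D)
      have "((\<lambda>s. g i j (plane_rotation N i j s * Q)) has_real_derivative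
        (d i j j i (plane_rotation N i j t * Q) - d i j i j (plane_rotation N i j t * Q)) * exp (c * mat_trace (plane_rotation N i j t * Q))
        + exp (c * mat_trace (plane_rotation N i j t * Q))
          * (c * ((plane_rotation N i j t * Q) $$ (j, i) - (plane_rotation N i j t * Q) $$ (i, j)))
          * (((plane_rotation N i j t * Q) ^\<^sub>m k) $$ (j, i) - ((plane_rotation N i j t * Q) ^\<^sub>m k) $$ (i, j))) (at t)"
        unfolding g_def d_def
        by (intro DERIV_mult DERIV_diff DERIV_fun_exp DERIV_cmult plane_rotation_pow_deriv
            mat_trace_rotation_deriv ij False Q)
      then show "((\<lambda>s. g i j (plane_rotation N i j s * Q)) has_real_derivative dg i j (plane_rotation N i j t * Q)) (at t)"
        by (rule DERIV_cong) (simp add: dg_def algebra_simps)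
    qed
  qed
  have int: "integrable M (\<lambda>x. dg i j (Y x) * W x)" if "i < N" "j < N" for i j
  proof (rule Bochner_Integration.integrable_bound)
    show "integrable M (\<lambda>x. ((4 * real k + \<bar>c\<bar> * (2 * 2)) * ?E) * W x)" using W by simp
    show "(\<lambda>x. dg i j (Y x) * W x) \<in> borel_measurable M"
      using measurable_compose[OF Y dgm[OF that]] borel_measurable_integrable[OF W] by simp
    show "AE x in M. norm (dg i j (Y x) * W x) \<le> norm (((4 * real k + \<bar>c\<bar> * (2 * 2)) * ?E) * W x)"
      using dgb[OF that] measurable_space[OF Y]
      by (intro AE_I2) (auto simp: abs_mult[of _ "W _"] abs_mult[of "4 * real k + \<bar>c\<bar> * (2 * 2)"] intro!: mult_right_mono)
  qed
  have sum_dg: "(\<Sum>i<N. \<Sum>j<N. dg i j Q) = 2 * ((\<Sum>m<k. mat_trace (transpose_mat (Q ^\<^sub>m m) * Q ^\<^sub>m (k - m))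
        - mat_trace (Q ^\<^sub>m m) * mat_trace (Q ^\<^sub>m (k - m)))
      + c * (mat_trace (Q ^\<^sub>m (k - 1)) - mat_trace (Q ^\<^sub>m (k + 1)))) * exp (c * mat_trace Q)"
    if Q: "Q \<in> carrier (SO N)" for Q
  proof -
    have P: "Q ^\<^sub>m m \<in> carrier_mat N N" for m by (intro SO_D(1) SO_pow_closed Q)
    note Q' = SO_D(1)[OF Q]
    \<comment> \<open>The summand is symmetric in \<open>i\<close> and \<open>j\<close>, so ordered
      pairs count each plane twice; this is the factor 2 here and in \<open>c2\<close>.\<close>
    have d2: "(\<Sum>i<N. \<Sum>j<N. d i j j i Q - d i j i j Q)
        = 2 * (\<Sum>m<k. mat_trace (transpose_mat (Q ^\<^sub>m m) * Q ^\<^sub>m (k - m)) - mat_trace (Q ^\<^sub>m m) * mat_trace (Q ^\<^sub>m (k - m)))"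
    proof -
      have "(\<Sum>i<N. \<Sum>j<N. d i j j i Q - d i j i j Q) = (\<Sum>m<k. \<Sum>i<N. \<Sum>j<N.
          ((Q ^\<^sub>m m) $$ (j, i) * (Q ^\<^sub>m (k - m)) $$ (j, i) - (Q ^\<^sub>m m) $$ (j, j) * (Q ^\<^sub>m (k - m)) $$ (i, i))
          - ((Q ^\<^sub>m m) $$ (i, i) * (Q ^\<^sub>m (k - m)) $$ (j, j) - (Q ^\<^sub>m m) $$ (i, j) * (Q ^\<^sub>m (k - m)) $$ (i, j)))"
        unfolding d_def sum_subtractf[symmetric] by (subst (2) sum.swap, subst sum.swap) (rule refl)
      also have "\<dots> = (\<Sum>m<k. 2 * (mat_trace (transpose_mat (Q ^\<^sub>m m) * Q ^\<^sub>m (k - m)) - mat_trace (Q ^\<^sub>m m) * mat_trace (Q ^\<^sub>m (k - m))))"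
        by (simp add: sum_subtractf sum_pair_entries[OF P P])
      finally show ?thesis by (simp add: sum_distrib_left)
    qed
    have "(\<Sum>i<N. \<Sum>j<N. ((Q ^\<^sub>m k) $$ (j, i) - (Q ^\<^sub>m k) $$ (i, j)) * (Q $$ (j, i) - Q $$ (i, j)))
      = 2 * (mat_trace (transpose_mat (Q ^\<^sub>m k) * Q) - mat_trace (Q ^\<^sub>m k * Q))"
      by (simp add: left_diff_distrib right_diff_distrib sum_subtractf sum_pair_entries[OF P Q'])
    also have "mat_trace (Q ^\<^sub>m k * Q) = mat_trace (Q ^\<^sub>m (k + 1))" by simp
    \<comment> \<open>This needs \<open>k \<ge> 1\<close>: one factor of the transposed power is
      split off, and conjugation by the transpose of \<open>Q\<close>, which is its inverse, turns
      the rest into the transpose of the power \<open>k - 1\<close>. Transposition does not change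
      the trace.\<close>
    also have "mat_trace (transpose_mat (Q ^\<^sub>m k) * Q) = mat_trace (Q ^\<^sub>m (k - 1))"
    proof -
      obtain l where l: "k = Suc l" using k by (cases k) auto
      have "transpose_mat (Q ^\<^sub>m k) * Q = transpose_mat Q * transpose_mat (Q ^\<^sub>m l) * Q"
        using transpose_mult[OF P Q'] by (simp add: l)
      also have "\<dots> = transpose_mat Q * transpose_mat (Q ^\<^sub>m l) * transpose_mat (transpose_mat Q)" by simp
      finally have "mat_trace (transpose_mat (Q ^\<^sub>m k) * Q) = mat_trace (transpose_mat (Q ^\<^sub>m l))"
        using mat_trace_conj[OF SO_transpose_closed[OF Q], of "transpose_mat (Q ^\<^sub>m l)"] P by simp
      then show ?thesis using mat_trace_transpose[OF P] by (simp add: l)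
    qed
    finally have c2: "(\<Sum>i<N. \<Sum>j<N. ((Q ^\<^sub>m k) $$ (j, i) - (Q ^\<^sub>m k) $$ (i, j)) * (Q $$ (j, i) - Q $$ (i, j)))
      = 2 * (mat_trace (Q ^\<^sub>m (k - 1)) - mat_trace (Q ^\<^sub>m (k + 1)))" .
    have "(\<Sum>i<N. \<Sum>j<N. dg i j Q) = ((\<Sum>i<N. \<Sum>j<N. d i j j i Q - d i j i j Q)
      + c * (\<Sum>i<N. \<Sum>j<N. ((Q ^\<^sub>m k) $$ (j, i) - (Q ^\<^sub>m k) $$ (i, j)) * (Q $$ (j, i) - Q $$ (i, j)))) * exp (c * mat_trace Q)"
      unfolding dg_def sum_distrib_right[symmetric] sum.distrib sum_distrib_left[symmetric] ..
    then show ?thesis unfolding d2 c2 by (simp add: algebra_simps)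
  qed
  let ?G = "\<lambda>x. ((\<Sum>m<k. mat_trace (transpose_mat (Y x ^\<^sub>m m) * Y x ^\<^sub>m (k - m))
        - mat_trace (Y x ^\<^sub>m m) * mat_trace (Y x ^\<^sub>m (k - m)))
      + c * (mat_trace (Y x ^\<^sub>m (k - 1)) - mat_trace (Y x ^\<^sub>m (k + 1)))) * exp (c * mat_trace (Y x)) * W x"
  have "(\<integral>x. 2 * ?G x \<partial>M) = (\<integral>x. (\<Sum>i<N. \<Sum>j<N. dg i j (Y x) * W x) \<partial>M)"
  proof (rule Bochner_Integration.integral_cong[OF refl])
    fix x assume "x \<in> space M"
    then have "Y x \<in> carrier (SO N)" using measurable_space[OF Y] by simp
    then show "2 * ?G x = (\<Sum>i<N. \<Sum>j<N. dg i j (Y x) * W x)"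
      unfolding sum_distrib_right[symmetric] by (simp add: sum_dg)
  qed
  also have "\<dots> = (\<Sum>i<N. \<Sum>j<N. \<integral>x. dg i j (Y x) * W x \<partial>M)"
    by (subst Bochner_Integration.integral_sum, (intro Bochner_Integration.integrable_sum int; simp),
        intro sum.cong refl Bochner_Integration.integral_sum int) auto
  also have "\<dots> = 0" by (simp add: zero)
  finally show ?thesis by simp
qed

section \<open>Walks and plaquettes\<close>

text \<open>No condition is put on edges outside the region, where points of the product space carry
  only a default value.\<close>

definition SO_config :: "nat \<Rightarrow> site set \<Rightarrow> config \<Rightarrow> bool" where
  "SO_config N \<Lambda> Q \<longleftrightarrow> (\<forall>e\<in>pos_edges_in \<Lambda>. Q e \<in> carrier (SO N))"

definition edges_in :: "site set \<Rightarrow> edge set" where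
  "edges_in \<Lambda> = {e \<in> edges. fst e \<in> \<Lambda> \<and> snd e \<in> \<Lambda>}"

lemma edge_cases:
  assumes "e \<in> edges_in \<Lambda>"
  obtains "e \<in> pos_edges" "e \<in> pos_edges_in \<Lambda>" "rev_edge e \<notin> pos_edges"
  | "e \<notin> pos_edges" "rev_edge e \<in> pos_edges_in \<Lambda>" "rev_edge e \<in> pos_edges"
proof (cases "e \<in> pos_edges")
  case True
  then show thesis
    using assms that(1)
    by (auto simp: edges_in_def pos_edges_in_def pos_edges_def edges_def rev_edge_def lex_less_def)
next
  case False
  obtain a b c d where e: "e = ((a, b), (c, d))" by (metis surj_pair)
  have "\<bar>a - c\<bar> + \<bar>b - d\<bar> = 1" "\<not> (a < c \<or> a = c \<and> b < d)"
    using assms False by (auto simp: edges_in_def pos_edges_def edges_def lex_less_def e)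
  then have "c < a \<or> c = a \<and> d < b" by linarith
  then have "rev_edge e \<in> pos_edges_in \<Lambda>"
    using assms by (auto simp: edges_in_def pos_edges_in_def pos_edges_def edges_def rev_edge_def lex_less_def e)
  then show thesis using False that(2) by (simp add: pos_edges_in_def)
qed

lemma rev_edge_in [simp]: "rev_edge e \<in> edges_in \<Lambda> \<longleftrightarrow> e \<in> edges_in \<Lambda>"
  by (auto simp: edges_in_def edges_def rev_edge_def)

lemma rev_rev_edge [simp]: "rev_edge (rev_edge e) = e"
  by (simp add: rev_edge_def)

lemma edge_matrix_eq:
  assumes "SO_config N \<Lambda> Q" "e \<in> edges_in \<Lambda>"
  shows "edge_matrix N Q e = (if e \<in> pos_edges then Q e else transpose_mat (Q (rev_edge e)))"
  using assms(2)
proof (cases e rule: edge_cases)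
  case 2
  then have "Q (rev_edge e) \<in> carrier (SO N)" using assms(1) by (simp add: SO_config_def)
  then show ?thesis by (simp add: edge_matrix_def SO_inv)
qed (simp add: edge_matrix_def)

lemma edge_matrix_SO:
  assumes "SO_config N \<Lambda> Q" "e \<in> edges_in \<Lambda>"
  shows "edge_matrix N Q e \<in> carrier (SO N)"
  using assms(2)
proof (cases e rule: edge_cases)
  case 2
  then have "Q (rev_edge e) \<in> carrier (SO N)" using assms(1) by (simp add: SO_config_def)
  then show ?thesis using 2 by (simp add: edge_matrix_eq[OF assms] SO_transpose_closed)
qed (use assms in \<open>simp add: edge_matrix_eq[OF assms] SO_config_def\<close>)

lemma edge_matrix_rev:
  assumes "SO_config N \<Lambda> Q" "e \<in> edges_in \<Lambda>"
  shows "edge_matrix N Q (rev_edge e) = transpose_mat (edge_matrix N Q e)"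
  using assms(2) by (cases e rule: edge_cases) (simp_all add: edge_matrix_eq[OF assms(1)] assms(2))

lemma path_matrix_Nil [simp]: "path_matrix N Q [] = 1\<^sub>m N"
  and path_matrix_Cons [simp]: "path_matrix N Q (e # es) = edge_matrix N Q e * path_matrix N Q es"
  by (simp_all add: path_matrix_def)

lemma path_matrix_SO:
  assumes "SO_config N \<Lambda> Q" "set es \<subseteq> edges_in \<Lambda>"
  shows "path_matrix N Q es \<in> carrier (SO N)"
  using assms(2) by (induction es) (auto intro: SO_one_closed SO_mult_closed edge_matrix_SO[OF assms(1)])

lemma path_matrix_append:
  assumes "SO_config N \<Lambda> Q" "set es \<subseteq> edges_in \<Lambda>" "set es' \<subseteq> edges_in \<Lambda>"
  shows "path_matrix N Q (es @ es') = path_matrix N Q es * path_matrix N Q es'"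
  using assms(2)
proof (induction es)
  case Nil
  then show ?case using SO_D(1)[OF path_matrix_SO[OF assms(1,3)]] by simp
next
  case (Cons e es)
  then show ?case
    using SO_D(1)[OF path_matrix_SO[OF assms(1,3)]] SO_D(1)[OF path_matrix_SO[OF assms(1), of es]]
      SO_D(1)[OF edge_matrix_SO[OF assms(1), of e]]
    by (simp add: assoc_mult_mat[of _ N N _ N _ N])
qed

lemma wilson_rotate:
  assumes "SO_config N \<Lambda> Q" "set es \<subseteq> edges_in \<Lambda>"
  shows "wilson N (rotate k es) Q = wilson N es Q"
proof -
  let ?a = "take (k mod length es) es" and ?b = "drop (k mod length es) es"
  have s: "set ?a \<subseteq> edges_in \<Lambda>" "set ?b \<subseteq> edges_in \<Lambda>"
    using assms(2) set_take_subset set_drop_subset by (metis subset_trans)+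
  have "mat_trace (path_matrix N Q (?b @ ?a)) = mat_trace (path_matrix N Q (?a @ ?b))"
    unfolding path_matrix_append[OF assms(1) s] path_matrix_append[OF assms(1) s(2,1)]
    by (intro mat_trace_comm[of _ N] SO_D(1) path_matrix_SO[OF assms(1)] s)
  then show ?thesis by (simp add: wilson_def rotate_drop_take)
qed

lemma path_matrix_reverse:
  assumes "SO_config N \<Lambda> Q" "set es \<subseteq> edges_in \<Lambda>"
  shows "path_matrix N Q (map rev_edge (rev es)) = transpose_mat (path_matrix N Q es)"
  using assms(2)
proof (induction es)
  case (Cons e es)
  have E: "edge_matrix N Q e \<in> carrier_mat N N" "edge_matrix N Q (rev_edge e) \<in> carrier_mat N N"
    using Cons.prems edge_matrix_SO[OF assms(1), of e] edge_matrix_SO[OF assms(1), of "rev_edge e"]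
    by (auto dest: SO_D(1))
  have P: "path_matrix N Q es \<in> carrier_mat N N"
    using Cons.prems path_matrix_SO[OF assms(1), of es] by (auto dest: SO_D(1))
  have "path_matrix N Q (map rev_edge (rev (e # es)))
      = path_matrix N Q (map rev_edge (rev es)) * path_matrix N Q [rev_edge e]"
    using path_matrix_append[OF assms(1), of "map rev_edge (rev es)" "[rev_edge e]"] Cons.prems
    by (auto simp: image_subset_iff)
  also have "\<dots> = transpose_mat (path_matrix N Q es) * transpose_mat (edge_matrix N Q e)"
    using Cons E edge_matrix_rev[OF assms(1), of e] by simp
  also have "\<dots> = transpose_mat (path_matrix N Q (e # es))"
    using transpose_mult[OF E(1) P] by simp
  finally show ?case .
qed (simp)

lemma wilson_reverse:
  assumes "SO_config N \<Lambda> Q" "set es \<subseteq> edges_in \<Lambda>"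
  shows "wilson N (map rev_edge (rev es)) Q = wilson N es Q"
  unfolding wilson_def path_matrix_reverse[OF assms]
  by (rule mat_trace_transpose[OF SO_D(1)[OF path_matrix_SO[OF assms]]])

lemma wilson_bound:
  assumes "SO_config N \<Lambda> Q" "set es \<subseteq> edges_in \<Lambda>"
  shows "\<bar>wilson N es Q\<bar> \<le> real N"
  unfolding wilson_def by (rule mat_trace_bound[OF path_matrix_SO[OF assms]])

definition power_loop :: "edge list \<Rightarrow> nat \<Rightarrow> edge list" where
  "power_loop p k = concat (replicate k p)"

lemma set_power_loop: "set (power_loop p k) \<subseteq> set p"
  by (induction k) (auto simp: power_loop_def)

text \<open>Needed because matrix powers append a factor on the right while
  \<open>power_loop\<close> prepends a copy of the loop on the left.\<close>

lemma pow_mat_commute: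
  assumes "A \<in> carrier_mat n n"
  shows "A * A ^\<^sub>m k = A ^\<^sub>m k * A"
proof (induction k)
  case (Suc k)
  have "A * (A ^\<^sub>m k * A) = A * A ^\<^sub>m k * A"
    using assms by (simp add: assoc_mult_mat[of A n n _ n A n])
  then show ?case using Suc by simp
qed (use assms in auto)

lemma path_matrix_power_loop:
  assumes "SO_config N \<Lambda> Q" "set p \<subseteq> edges_in \<Lambda>"
  shows "path_matrix N Q (power_loop p k) = path_matrix N Q p ^\<^sub>m k"
proof (induction k)
  case 0
  show ?case using SO_D(5)[OF path_matrix_SO[OF assms]] by (simp add: power_loop_def)
next
  case (Suc k)
  have "power_loop p (Suc k) = p @ power_loop p k" by (simp add: power_loop_def)
  then have "path_matrix N Q (power_loop p (Suc k)) = path_matrix N Q p * path_matrix N Q p ^\<^sub>m k"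
    using path_matrix_append[OF assms, of "power_loop p k"] set_power_loop[of p k] assms(2) Suc by auto
  then show ?case using pow_mat_commute[OF SO_D(1)[OF path_matrix_SO[OF assms]]] by simp
qed

lemma length_power_loop: "length (power_loop p k) = k * length p"
  by (induction k) (auto simp: power_loop_def)

lemma nth_power_loop: "i < k * length p \<Longrightarrow> power_loop p k ! i = p ! (i mod length p)"
proof (induction k arbitrary: i)
  case (Suc k)
  have s: "power_loop p (Suc k) = p @ power_loop p k" by (simp add: power_loop_def)
  show ?case
  proof (cases "i < length p")
    case False
    then have "power_loop p (Suc k) ! i = power_loop p k ! (i - length p)" by (simp add: s nth_append)
    also have "\<dots> = p ! ((i - length p) mod length p)" using Suc.prems False by (intro Suc.IH) auto
    also have "(i - length p) mod length p = i mod length p" using False by (simp add: le_mod_geq)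
    finally show ?thesis .
  qed (simp add: s nth_append)
qed (simp)

text \<open>At the seams between copies the last edge of \<open>p\<close> is followed by its first.
  The conditions on \<open>p\<close> are cyclic, so they cover this pair as well.\<close>

lemma is_loop_power_loop:
  assumes "is_loop p" "k \<ge> 1"
  shows "is_loop (power_loop p k)"
proof -
  have p: "p \<noteq> []" using assms by (simp add: is_loop_def closed_walk_def)
  then have len: "length (power_loop p k) > 0" using assms(2) by (simp add: length_power_loop)
  have *: "power_loop p k ! i = p ! (i mod length p)"
     "power_loop p k ! (Suc i mod length (power_loop p k)) = p ! (Suc (i mod length p) mod length p)"
    if "i < length (power_loop p k)" for i
  proof -
    show "power_loop p k ! i = p ! (i mod length p)"
      using that by (intro nth_power_loop) (simp add: length_power_loop)
    have "Suc i mod length (power_loop p k) < length (power_loop p k)" using len by (intro mod_less_divisor)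
    then have "power_loop p k ! (Suc i mod length (power_loop p k)) = p ! (Suc i mod length (power_loop p k) mod length p)"
      by (intro nth_power_loop) (simp add: length_power_loop)
    also have "Suc i mod length (power_loop p k) mod length p = Suc (i mod length p) mod length p"
      by (simp add: length_power_loop mod_mod_cancel mod_Suc_eq)
    finally show "power_loop p k ! (Suc i mod length (power_loop p k)) = p ! (Suc (i mod length p) mod length p)" .
  qed
  have P: "\<forall>i<length (power_loop p k). P (power_loop p k ! i) (power_loop p k ! (Suc i mod length (power_loop p k)))"
    if "\<forall>i<length p. P (p ! i) (p ! (Suc i mod length p))" for P
  proof (intro allI impI)
    fix i assume i: "i < length (power_loop p k)"
    have "i mod length p < length p" using p by simp
    with that show "P (power_loop p k ! i) (power_loop p k ! (Suc i mod length (power_loop p k)))"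
      unfolding *(1)[OF i] *(2)[OF i] by blast
  qed
  show ?thesis
    using assms(1) len set_power_loop[of p k] P[of "\<lambda>e e'. snd e = fst e'"] P[of "\<lambda>e e'. e' \<noteq> rev_edge e"]
    unfolding is_loop_def closed_walk_def by auto
qed

text \<open>Clockwise from the lower left corner: lexicographically \<open>(x, y + 1)\<close> comes
  right after \<open>(x, y)\<close>, so this is the representative of the positively oriented
  plaquette.\<close>

definition unit_square :: "int \<Rightarrow> int \<Rightarrow> edge list" where
  "unit_square x y = [((x, y), (x, y + 1)), ((x, y + 1), (x + 1, y + 1)),
     ((x + 1, y + 1), (x + 1, y)), ((x + 1, y), (x, y))]"

lemma unit_square_is_loop:
  "is_loop (unit_square x y)" "is_loop (map rev_edge (rev (unit_square x y)))"
proof -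
  have less4: "i = 0 \<or> i = 1 \<or> i = 2 \<or> i = 3" if "i < 4" for i :: nat
    using that by linarith
  have "snd (unit_square x y ! i) = fst (unit_square x y ! (Suc i mod 4)) \<and>
      unit_square x y ! (Suc i mod 4) \<noteq> rev_edge (unit_square x y ! i)" if "i < 4" for i
    using less4[OF that] by (elim disjE) (simp_all add: unit_square_def rev_edge_def)
  moreover have "length (unit_square x y) = 4" "unit_square x y \<noteq> []" "set (unit_square x y) \<subseteq> edges"
    by (simp_all add: unit_square_def edges_def)
  ultimately show "is_loop (unit_square x y)"
    by (simp add: is_loop_def closed_walk_def)
  let ?r = "map rev_edge (rev (unit_square x y))"
  have r: "?r = [((x, y), (x + 1, y)), ((x + 1, y), (x + 1, y + 1)),
      ((x + 1, y + 1), (x, y + 1)), ((x, y + 1), (x, y))]"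
    by (simp add: unit_square_def rev_edge_def)
  have "snd (?r ! i) = fst (?r ! (Suc i mod 4)) \<and> ?r ! (Suc i mod 4) \<noteq> rev_edge (?r ! i)" if "i < 4" for i
    unfolding r using less4[OF that] by (elim disjE) (simp_all add: rev_edge_def)
  moreover have "length ?r = 4" "?r \<noteq> []" "set ?r \<subseteq> edges"
    unfolding r by (simp_all add: edges_def)
  ultimately show "is_loop ?r"
    unfolding is_loop_def closed_walk_def by metis
qed

lemma cyclic_pairs_rotate:
  assumes "\<forall>i<length es. P (es ! i) (es ! (Suc i mod length es))"
  shows "\<forall>i<length (rotate k es). P (rotate k es ! i) (rotate k es ! (Suc i mod length (rotate k es)))"
proof (intro allI impI)
  fix i assume "i < length (rotate k es)"
  then have i: "i < length es" "0 < length es" by auto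
  then have "rotate k es ! i = es ! ((k + i) mod length es)" by (intro nth_rotate)
  moreover have "rotate k es ! (Suc i mod length es) = es ! (Suc ((k + i) mod length es) mod length es)"
    using i by (simp add: nth_rotate mod_add_right_eq mod_Suc_eq del: mod_less)
  moreover have "P (es ! ((k + i) mod length es)) (es ! (Suc ((k + i) mod length es) mod length es))"
    using assms i by simp
  ultimately show "P (rotate k es ! i) (rotate k es ! (Suc i mod length (rotate k es)))" by simp
qed

lemma closed_walk_rotate: "closed_walk es \<Longrightarrow> closed_walk (rotate k es)"
  using cyclic_pairs_rotate[of es "\<lambda>e e'. snd e = fst e'" k] by (simp add: closed_walk_def)

lemma is_loop_rotate: "is_loop es \<Longrightarrow> is_loop (rotate k es)"
  using cyclic_pairs_rotate[of es "\<lambda>e e'. e' \<noteq> rev_edge e" k] closed_walk_rotate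
  by (simp add: is_loop_def)

text \<open>The walk starts at the lower left corner, and the corner diagonal to it can be neither
  second nor last, because no edge joins the two. Only the two ways around the square
  remain.\<close>

lemma plaquette_from_least:
  assumes "plaquette es" "lex_least (sites es) (fst (hd es))"
  shows "\<exists>x y. es = unit_square x y \<or> es = map rev_edge (rev (unit_square x y))"
proof -
  from assms(1) obtain x y where len: "length es = 4" and cw: "closed_walk es"
    and S: "sites es = {(x, y), (x + 1, y), (x + 1, y + 1), (x, y + 1)}"
    unfolding plaquette_def by blast
  obtain e0 e1 e2 e3 where es: "es = [e0, e1, e2, e3]"
    using len by (auto simp: numeral_eq_Suc length_Suc_conv)
  have step: "snd (es ! i) = fst (es ! (Suc i mod 4))" if "i < 4" for i
    using cw that len by (simp add: closed_walk_def)
  have cw': "snd e0 = fst e1" "snd e1 = fst e2" "snd e2 = fst e3" "snd e3 = fst e0"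
    using step[of 0] step[of 1] step[of 2] step[of 3] by (simp_all add: es)
  have sub: "set es \<subseteq> edges" using cw by (simp add: closed_walk_def)
  obtain a b c d where abcd: "a = fst e0" "b = fst e1" "c = fst e2" "d = fst e3" by blast
  have es': "es = [(a, b), (b, c), (c, d), (d, a)]"
    using cw' by (simp add: es abcd prod_eq_iff)
  have "sites es = {a, b, c, d}" by (simp add: sites_def es abcd)
  with S have S': "{a, b, c, d} = {(x, y), (x + 1, y), (x + 1, y + 1), (x, y + 1)}" by simp
  have "card (set (map fst es)) = length (map fst es)"
    using S len by (simp add: sites_def)
  then have "distinct (map fst es)" by (rule card_distinct)
  then have dist: "distinct [a, b, c, d]" by (simp add: es abcd)
  have ad: "(a, b) \<in> edges" "(b, c) \<in> edges" "(c, d) \<in> edges" "(d, a) \<in> edges"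
    using sub by (auto simp: es')
  have "lex_least (sites es) a" using assms(2) by (simp add: es abcd)
  then have "a \<in> sites es" "(x, y) \<noteq> a \<longrightarrow> lex_less a (x, y)"
    unfolding lex_least_def S by blast+
  then have a: "a = (x, y)" unfolding S by (auto simp: lex_less_def)
  have "b \<in> {(x, y), (x + 1, y), (x + 1, y + 1), (x, y + 1)}"
    "c \<in> {(x, y), (x + 1, y), (x + 1, y + 1), (x, y + 1)}"
    "d \<in> {(x, y), (x + 1, y), (x + 1, y + 1), (x, y + 1)}"
    unfolding S'[symmetric] by simp_all
  moreover have "b \<noteq> (x + 1, y + 1)" "d \<noteq> (x + 1, y + 1)"
    using ad(1,4) by (auto simp: a edges_def)
  ultimately have "b = (x, y + 1) \<and> c = (x + 1, y + 1) \<and> d = (x + 1, y)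
      \<or> b = (x + 1, y) \<and> c = (x + 1, y + 1) \<and> d = (x, y + 1)"
    using dist by (auto simp: a)
  then show ?thesis
    by (auto simp: es' a unit_square_def rev_edge_def)
qed

lemma sites_unit_square:
  "sites (unit_square x y) = {(x, y), (x + 1, y), (x + 1, y + 1), (x, y + 1)}"
  "sites (map rev_edge (rev (unit_square x y))) = {(x, y), (x + 1, y), (x + 1, y + 1), (x, y + 1)}"
  by (auto simp: sites_def unit_square_def rev_edge_def)

lemma plaquette_unit_square: "plaquette (unit_square x y)"
proof -
  have "closed_walk (unit_square x y)" using unit_square_is_loop by (simp add: is_loop_def)
  then show ?thesis
    using sites_unit_square(1)[of x y] unfolding plaquette_def by (auto simp: unit_square_def)
qed

lemma positively_oriented_iff:
  assumes "sites es = {(x, y), (x + 1, y), (x + 1, y + 1), (x, y + 1)}"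
  shows "positively_oriented es \<longleftrightarrow> ((x, y), (x, y + 1)) \<in> set es"
proof -
  let ?S = "{(x, y), (x + 1, y), (x + 1, y + 1), (x, y + 1)}"
  have 1: "lex_least ?S u \<longleftrightarrow> u = (x, y)" for u
  proof
    assume "lex_least ?S u"
    then have "u \<in> ?S" "(x, y) \<noteq> u \<longrightarrow> lex_less u (x, y)"
      unfolding lex_least_def by blast+
    then show "u = (x, y)" by (auto simp: lex_less_def)
  qed (auto simp: lex_least_def lex_less_def)
  have 2: "lex_least (?S - {(x, y)}) u \<longleftrightarrow> u = (x, y + 1)" for u
  proof
    assume "lex_least (?S - {(x, y)}) u"
    then have "u \<in> ?S - {(x, y)}" "(x, y + 1) \<noteq> u \<longrightarrow> lex_less u (x, y + 1)"
      unfolding lex_least_def by auto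
    then show "u = (x, y + 1)" by (auto simp: lex_less_def)
  qed (auto simp: lex_least_def lex_less_def)
  have "positively_oriented es \<longleftrightarrow>
      (\<exists>(u, v)\<in>set es. u = (x, y) \<and> lex_least (?S - {u}) v)"
    unfolding positively_oriented_def assms 1 ..
  also have "\<dots> \<longleftrightarrow> (\<exists>(u, v)\<in>set es. u = (x, y) \<and> v = (x, y + 1))"
    using 2 by (intro bex_cong) (auto simp del: insert_Diff_single Diff_insert_absorb)
  finally show ?thesis by auto
qed

lemma pos_plaquettes_in_eq:
  "pos_plaquettes_in \<Lambda> = {unit_square x y |x y. {(x, y), (x + 1, y), (x + 1, y + 1), (x, y + 1)} \<subseteq> \<Lambda>}"
proof (intro equalityI subsetI)
  fix es assume es: "es \<in> pos_plaquettes_in \<Lambda>"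
  then obtain x y where "es = unit_square x y \<or> es = map rev_edge (rev (unit_square x y))"
    using plaquette_from_least[of es] by (auto simp: pos_plaquettes_in_def)
  moreover have "\<not> positively_oriented (map rev_edge (rev (unit_square x y)))"
    unfolding positively_oriented_iff[OF sites_unit_square(2)]
    by (simp add: unit_square_def rev_edge_def)
  ultimately have "es = unit_square x y" using es by (auto simp: pos_plaquettes_in_def)
  then show "es \<in> {unit_square x y |x y. {(x, y), (x + 1, y), (x + 1, y + 1), (x, y + 1)} \<subseteq> \<Lambda>}"
    using es by (auto simp: pos_plaquettes_in_def unit_square_def)
next
  fix es assume "es \<in> {unit_square x y |x y. {(x, y), (x + 1, y), (x + 1, y + 1), (x, y + 1)} \<subseteq> \<Lambda>}"
  then obtain x y where es: "es = unit_square x y" "{(x, y), (x + 1, y), (x + 1, y + 1), (x, y + 1)} \<subseteq> \<Lambda>" by blast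
  have "positively_oriented es"
    unfolding es(1) positively_oriented_iff[OF sites_unit_square(1)] by (simp add: unit_square_def)
  moreover have "lex_least (sites es) (fst (hd es))"
    unfolding es(1) sites_unit_square by (simp add: unit_square_def lex_least_def lex_less_def)
  moreover have "\<forall>e\<in>set es. fst e \<in> \<Lambda> \<and> snd e \<in> \<Lambda>"
    using es(2) by (simp add: es(1) unit_square_def)
  ultimately show "es \<in> pos_plaquettes_in \<Lambda>"
    using plaquette_unit_square[of x y] by (simp add: pos_plaquettes_in_def es(1))
qed

text \<open>Rotating the walk to its least vertex is harmless by cyclicity of the trace; reversing
  it transposes the matrix product, which keeps the trace. The square is chosen before
  \<open>N\<close>, \<open>\<Lambda>\<close> and \<open>Q\<close>, as the limit in N
  requires.\<close>

lemma wilson_plaquette: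
  assumes "plaquette p"
  shows "\<exists>x y. is_loop p \<and> (\<forall>N \<Lambda> Q. SO_config N \<Lambda> Q \<longrightarrow> set (unit_square x y) \<subseteq> edges_in \<Lambda> \<longrightarrow>
      wilson N p Q = wilson N (unit_square x y) Q)"
proof -
  obtain k where k: "lex_least (sites (rotate k p)) (fst (hd (rotate k p)))"
    using plaquette_representative[OF assms] by blast
  have "plaquette (rotate k p)"
    using assms closed_walk_rotate[of p k] by (simp add: plaquette_def sites_def)
  then obtain x y where xy: "rotate k p = unit_square x y \<or> rotate k p = map rev_edge (rev (unit_square x y))"
    using plaquette_from_least k by blast
  then have "set (rotate k p) = set (unit_square x y) \<or> set (rotate k p) = rev_edge ` set (unit_square x y)"
    by (metis list.set_map set_rev)
  then have s: "set p = set (unit_square x y) \<or> set p = rev_edge ` set (unit_square x y)" by simp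
  have "is_loop (rotate k p)" using xy unit_square_is_loop by metis
  then have "is_loop (rotate (length p - k mod length p) (rotate k p))" by (rule is_loop_rotate)
  moreover have "rotate (length p - k mod length p) (rotate k p) = p"
  proof -
    have "length p > 0" using assms by (auto simp: plaquette_def)
    then have "k mod length p < length p" by simp
    then show ?thesis
      by (subst (2) rotate_conv_mod) (simp add: rotate_rotate)
  qed
  ultimately have "is_loop p" by simp
  show ?thesis
  proof (intro exI conjI allI impI)
    show "is_loop p" by fact
    fix N \<Lambda> Q assume Q: "SO_config N \<Lambda> Q" "set (unit_square x y) \<subseteq> edges_in \<Lambda>"
    then have "set p \<subseteq> edges_in \<Lambda>" using s by (auto simp only: image_subset_iff rev_edge_in subset_iff)
    then have "wilson N p Q = wilson N (rotate k p) Q" using wilson_rotate Q(1) by metis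
    also have "\<dots> = wilson N (unit_square x y) Q"
      using xy wilson_reverse[OF Q] by auto
    finally show "wilson N p Q = wilson N (unit_square x y) Q" .
  qed
qed

section \<open>Shifting a row of edges\<close>

lemma haar_SO_D:
  assumes "haar_SO N M"
  shows "prob_space M" "sets M = sets (SO_borel N)" "space M = carrier (SO N)"
    "A \<in> carrier (SO N) \<Longrightarrow> distr M M (\<lambda>B. A * B) = M"
proof -
  show "prob_space M" "sets M = sets (SO_borel N)" using assms by (auto simp: haar_SO_def)
  then show "space M = carrier (SO N)" by (metis sets_eq_imp_space_eq space_SO_borel)
  show "distr M M (\<lambda>B. A * B) = M" if "A \<in> carrier (SO N)" using assms that by (auto simp: haar_SO_def)
qed

text \<open>Fubini: once the other coordinates are frozen, \<open>A Q\<close> is a fixed group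
  element because it does not depend on the coordinate \<open>e\<close>, and left invariance of Haar
  measure applies to the inner integral.\<close>

lemma integral_left_translate_coordinate:
  fixes f :: "('i \<Rightarrow> real mat) \<Rightarrow> real"
  assumes M: "haar_SO N M"
    and E: "finite E" "e \<in> E"
    and A: "A \<in> Pi\<^sub>M E (\<lambda>_. M) \<rightarrow>\<^sub>M SO_borel N" "\<And>Q B. A (Q(e := B)) = A Q"
    and f: "f \<in> borel_measurable (Pi\<^sub>M E (\<lambda>_. M))" "\<And>Q. Q \<in> space (Pi\<^sub>M E (\<lambda>_. M)) \<Longrightarrow> \<bar>f Q\<bar> \<le> C"
  shows "(\<integral>Q. f (Q(e := A Q * Q e)) \<partial>Pi\<^sub>M E (\<lambda>_. M)) = (\<integral>Q. f Q \<partial>Pi\<^sub>M E (\<lambda>_. M))"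
    and "(\<lambda>Q. Q(e := A Q * Q e)) \<in> Pi\<^sub>M E (\<lambda>_. M) \<rightarrow>\<^sub>M Pi\<^sub>M E (\<lambda>_. M)"
proof -
  note M' = haar_SO_D[OF M]
  interpret M: prob_space M by (rule M')
  interpret P: prob_space "Pi\<^sub>M E (\<lambda>_. M)" by (rule prob_space_PiM) (rule M')
  interpret ps: product_prob_space "\<lambda>_. M" E by standard
  have sb: "measurable K M = measurable K (SO_borel N)" for K :: "'k measure"
    using M'(2) by (intro measurable_cong_sets) auto
  have comp: "(\<lambda>Q. Q e) \<in> Pi\<^sub>M E (\<lambda>_. M) \<rightarrow>\<^sub>M SO_borel N"
    using measurable_component_singleton[OF E(2), of "\<lambda>_. M"] unfolding sb .
  have "(\<lambda>Q. A Q * Q e) \<in> Pi\<^sub>M E (\<lambda>_. M) \<rightarrow>\<^sub>M M"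
    unfolding sb by (rule measurable_SO_mult[OF A(1) comp])
  then show T: "(\<lambda>Q. Q(e := A Q * Q e)) \<in> Pi\<^sub>M E (\<lambda>_. M) \<rightarrow>\<^sub>M Pi\<^sub>M E (\<lambda>_. M)"
    using E by (intro measurable_fun_upd[where J = E]) auto
  have intf: "integrable (Pi\<^sub>M E (\<lambda>_. M)) f"
    using f by (intro P.integrable_const_bound[of _ C]) auto
  have intT: "integrable (Pi\<^sub>M E (\<lambda>_. M)) (\<lambda>Q. f (Q(e := A Q * Q e)))"
    using measurable_compose[OF T f(1)] f(2) measurable_space[OF T]
    by (intro P.integrable_const_bound[of _ C]) auto
  define E' where "E' = E - {e}"
  have E': "E = insert e E'" "finite E'" "e \<notin> E'" using E by (auto simp: E'_def)
  have "(\<integral>Q. f (Q(e := A Q * Q e)) \<partial>Pi\<^sub>M E (\<lambda>_. M)) =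
     (\<integral>x. (\<integral>z. f ((x(e := z))(e := A (x(e := z)) * (x(e := z)) e)) \<partial>M) \<partial>Pi\<^sub>M E' (\<lambda>_. M))"
    unfolding E'(1) by (rule ps.product_integral_insert) (use E' intT in auto)
  also have "\<dots> = (\<integral>x. (\<integral>z. f (x(e := z)) \<partial>M) \<partial>Pi\<^sub>M E' (\<lambda>_. M))"
  proof (rule Bochner_Integration.integral_cong[OF refl])
    fix x assume x: "x \<in> space (Pi\<^sub>M E' (\<lambda>_. M))"
    have upd: "(\<lambda>z. x(e := z)) \<in> M \<rightarrow>\<^sub>M Pi\<^sub>M E (\<lambda>_. M)"
      using E' x by (intro measurable_fun_upd[where J = E']) auto
    \<comment> \<open>\<open>x\<close> has no meaningful value at \<open>e\<close>, hence is not a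
      point of the full product. Filling in any group element there makes it one without changing
      \<open>A x\<close>.\<close>
    have "x(e := 1\<^sub>m N) \<in> space (Pi\<^sub>M E (\<lambda>_. M))"
      using measurable_space[OF upd] M'(3) SO_one_closed by auto
    then have Ax: "A x \<in> carrier (SO N)"
      using measurable_space[OF A(1)] A(2)[of x "1\<^sub>m N"] by fastforce
    have fx: "(\<lambda>z. f (x(e := z))) \<in> borel_measurable M"
      using measurable_compose[OF upd f(1)] .
    have "(\<lambda>B. A x * B) \<in> SO_borel N \<rightarrow>\<^sub>M SO_borel N"
      using Ax by (intro measurable_SO_mult) auto
    then have Am: "(\<lambda>B. A x * B) \<in> M \<rightarrow>\<^sub>M M"
      using M'(2) measurable_cong_sets by blast
    have "(\<integral>z. f ((x(e := z))(e := A (x(e := z)) * (x(e := z)) e)) \<partial>M) = (\<integral>z. f (x(e := A x * z)) \<partial>M)"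
      by (simp add: A(2))
    also have "\<dots> = (\<integral>z. f (x(e := z)) \<partial>distr M M (\<lambda>B. A x * B))"
      by (rule integral_distr[symmetric, OF Am fx])
    also have "\<dots> = (\<integral>z. f (x(e := z)) \<partial>M)" by (simp add: M'(4)[OF Ax])
    finally show "(\<integral>z. f ((x(e := z))(e := A (x(e := z)) * (x(e := z)) e)) \<partial>M) = (\<integral>z. f (x(e := z)) \<partial>M)" .
  qed
  also have "\<dots> = (\<integral>Q. f Q \<partial>Pi\<^sub>M E (\<lambda>_. M))"
    unfolding E'(1) by (rule ps.product_integral_insert[symmetric]) (use E' intf in auto)
  finally show "(\<integral>Q. f (Q(e := A Q * Q e)) \<partial>Pi\<^sub>M E (\<lambda>_. M)) = (\<integral>Q. f Q \<partial>Pi\<^sub>M E (\<lambda>_. M))" .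
qed

lemma SO_config_space:
  assumes "haar_SO N M" "Q \<in> space (Pi\<^sub>M (pos_edges_in \<Lambda>) (\<lambda>_. M))"
  shows "SO_config N \<Lambda> Q"
  using assms(2) haar_SO_D(3)[OF assms(1)] by (auto simp: SO_config_def space_PiM)

lemma finite_pos_edges_in: "finite \<Lambda> \<Longrightarrow> finite (pos_edges_in \<Lambda>)"
  by (rule finite_subset[of _ "\<Lambda> \<times> \<Lambda>"]) (auto simp: pos_edges_in_def)

lemma finite_pos_plaquettes_in:
  assumes "finite \<Lambda>"
  shows "finite (pos_plaquettes_in \<Lambda>)"
proof (rule finite_subset)
  show "pos_plaquettes_in \<Lambda> \<subseteq> (\<lambda>(x, y). unit_square x y) ` \<Lambda>"
    unfolding pos_plaquettes_in_eq by auto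
qed (use assms in simp)

lemma coordinate_measurable:
  assumes "haar_SO N M" "e \<in> E"
  shows "(\<lambda>Q. Q e) \<in> Pi\<^sub>M E (\<lambda>_. M) \<rightarrow>\<^sub>M SO_borel N"
  using measurable_component_singleton[OF assms(2), of "\<lambda>_. M"]
    measurable_cong_sets[OF refl haar_SO_D(2)[OF assms(1)]] by blast

lemma path_matrix_measurable:
  assumes M: "haar_SO N M" and "set es \<subseteq> edges_in \<Lambda>"
  shows "(\<lambda>Q. path_matrix N Q es) \<in> Pi\<^sub>M (pos_edges_in \<Lambda>) (\<lambda>_. M) \<rightarrow>\<^sub>M SO_borel N"
  using assms(2)
proof (induction es)
  case Nil
  then show ?case by (simp add: SO_one_closed)
next
  case (Cons e es)
  let ?P = "Pi\<^sub>M (pos_edges_in \<Lambda>) (\<lambda>_. M)"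
  have e: "e \<in> edges_in \<Lambda>" using Cons.prems by simp
  have "(\<lambda>Q. if e \<in> pos_edges then Q e else transpose_mat (Q (rev_edge e))) \<in> ?P \<rightarrow>\<^sub>M SO_borel N"
    using e by (cases e rule: edge_cases)
      (simp_all add: coordinate_measurable[OF M] measurable_SO_transpose)
  moreover have "edge_matrix N Q e = (if e \<in> pos_edges then Q e else transpose_mat (Q (rev_edge e)))"
    if "Q \<in> space ?P" for Q
    by (rule edge_matrix_eq[OF SO_config_space[OF M that] e])
  ultimately have "(\<lambda>Q. edge_matrix N Q e) \<in> ?P \<rightarrow>\<^sub>M SO_borel N"
    by (subst measurable_cong)
  then show ?case using Cons by (simp add: measurable_SO_mult)
qed

lemma wilson_measurable:
  assumes "haar_SO N M" "set es \<subseteq> edges_in \<Lambda>"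
  shows "wilson N es \<in> borel_measurable (Pi\<^sub>M (pos_edges_in \<Lambda>) (\<lambda>_. M))"
  unfolding wilson_def[abs_def] by (rule measurable_mat_trace[OF path_matrix_measurable[OF assms]])

lemma set_unit_square_in:
  "set (unit_square x y) \<subseteq> edges_in \<Lambda> \<longleftrightarrow> {(x, y), (x + 1, y), (x + 1, y + 1), (x, y + 1)} \<subseteq> \<Lambda>"
  by (auto simp: unit_square_def edges_in_def edges_def)

lemma path_matrix_unit_square:
  assumes Q: "SO_config N \<Lambda> Q" and sq: "set (unit_square x y) \<subseteq> edges_in \<Lambda>"
  shows "path_matrix N Q (unit_square x y) = Q ((x, y), (x, y + 1)) * (Q ((x, y + 1), (x + 1, y + 1)) *
     (transpose_mat (Q ((x + 1, y), (x + 1, y + 1))) * transpose_mat (Q ((x, y), (x + 1, y)))))"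
proof -
  have "((x, y), (x + 1, y)) \<in> pos_edges_in \<Lambda>"
    using sq unfolding set_unit_square_in by (auto simp: pos_edges_in_def pos_edges_def edges_def lex_less_def)
  then have "dim_row (Q ((x, y), (x + 1, y))) = N" "dim_col (Q ((x, y), (x + 1, y))) = N"
    using Q by (auto simp: SO_config_def dest: SO_D(5,6))
  then have "transpose_mat (Q ((x, y), (x + 1, y))) * 1\<^sub>m N = transpose_mat (Q ((x, y), (x + 1, y)))"
    by (intro right_mult_one_mat[of _ N N] carrier_matI) auto
  then show ?thesis
    using sq by (simp add: unit_square_def edge_matrix_eq[OF Q] pos_edges_def edges_def lex_less_def rev_edge_def)
qed

text \<open>Positions in the row are counted leftwards, starting with 0 at the left side of the
  square; \<open>horiz x y n\<close> joins the feet of positions \<open>n + 1\<close> and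
  \<open>n\<close>.\<close>

definition vert :: "int \<Rightarrow> int \<Rightarrow> nat \<Rightarrow> edge" where
  "vert x y n = ((x - int n, y), (x - int n, y + 1))"

definition horiz :: "int \<Rightarrow> int \<Rightarrow> nat \<Rightarrow> edge" where
  "horiz x y n = ((x - int n - 1, y), (x - int n, y))"

text \<open>The shift multiplies \<open>vert x y n\<close> from the left by \<open>A\<close> transported along the horizontal edges
  between the two positions. As these edges are not moved, the edges can be shifted one at a time.\<close>

primrec row_conj :: "int \<Rightarrow> int \<Rightarrow> real mat \<Rightarrow> nat \<Rightarrow> config \<Rightarrow> real mat" where
  "row_conj x y A 0 Q = A"
| "row_conj x y A (Suc n) Q = Q (horiz x y n) * row_conj x y A n Q * transpose_mat (Q (horiz x y n))"

primrec row_shift :: "int \<Rightarrow> int \<Rightarrow> real mat \<Rightarrow> nat \<Rightarrow> config \<Rightarrow> config" where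
  "row_shift x y A 0 Q = Q"
| "row_shift x y A (Suc n) Q = (row_shift x y A n Q)
     (vert x y n := row_conj x y A n (row_shift x y A n Q) * row_shift x y A n Q (vert x y n))"

lemma vert_inj: "vert x y n = vert x y m \<longleftrightarrow> n = m"
  by (auto simp: vert_def)

lemma horiz_neq_vert: "horiz x y n \<noteq> vert x y m"
  by (auto simp: vert_def horiz_def)

lemma row_conj_upd: "row_conj x y A n (Q(vert x y m := B)) = row_conj x y A n Q"
  by (induction n) (simp_all add: horiz_neq_vert)

lemma row_conj_row_shift [simp]: "row_conj x y A m (row_shift x y A n Q) = row_conj x y A m Q"
  by (induction n) (simp_all only: row_shift.simps row_conj_upd)

lemma row_shift_other: "e \<notin> vert x y ` {..<n} \<Longrightarrow> row_shift x y A n Q e = Q e"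
  by (induction n) (auto simp: lessThan_Suc)

lemma row_shift_vert:
  "m < n \<Longrightarrow> row_shift x y A n Q (vert x y m) = row_conj x y A m Q * Q (vert x y m)"
proof (induction n)
  case (Suc n)
  have "row_shift x y A n Q (vert x y n) = Q (vert x y n)"
    by (rule row_shift_other) (auto simp: vert_inj)
  with Suc show ?case by (cases "m = n") (auto simp: vert_inj)
qed (simp)

lemma row_conj_SO:
  assumes "A \<in> carrier (SO N)" "\<And>m. m < n \<Longrightarrow> Q (horiz x y m) \<in> carrier (SO N)"
  shows "row_conj x y A n Q \<in> carrier (SO N)"
  using assms(2) by (induction n) (auto simp: assms(1) SO_mult_closed SO_transpose_closed)

lemma row_conj_measurable:
  assumes M: "haar_SO N M" and A: "A \<in> carrier (SO N)" and h: "\<And>m. m < n \<Longrightarrow> horiz x y m \<in> E"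
  shows "row_conj x y A n \<in> Pi\<^sub>M E (\<lambda>_. M) \<rightarrow>\<^sub>M SO_borel N"
  using h
proof (induction n)
  case 0
  have "row_conj x y A 0 = (\<lambda>_. A)" by auto
  then show ?case using A by simp
next
  case (Suc n)
  have "row_conj x y A (Suc n) = (\<lambda>Q. Q (horiz x y n) * row_conj x y A n Q * transpose_mat (Q (horiz x y n)))"
    by auto
  moreover have "(\<lambda>Q. Q (horiz x y n)) \<in> Pi\<^sub>M E (\<lambda>_. M) \<rightarrow>\<^sub>M SO_borel N"
    using Suc.prems by (intro coordinate_measurable[OF M]) auto
  ultimately show ?case using Suc by (simp add: measurable_SO_mult measurable_SO_transpose)
qed

text \<open>The outermost translation is absorbed into the integrand, which is why the induction
  runs over all \<open>f\<close>. The condition \<open>Suc m < n\<close> matters: \<open>n\<close>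
  vertical edges need only \<open>n - 1\<close> horizontal ones, and one more would leave the
  box.\<close>

lemma integral_row_shift:
  fixes f :: "config \<Rightarrow> real"
  assumes M: "haar_SO N M" and A: "A \<in> carrier (SO N)" and E: "finite E"
    and v: "\<And>m. m < n \<Longrightarrow> vert x y m \<in> E"
    and h: "\<And>m. Suc m < n \<Longrightarrow> horiz x y m \<in> E"
    and f: "f \<in> borel_measurable (Pi\<^sub>M E (\<lambda>_. M))" "\<And>Q. Q \<in> space (Pi\<^sub>M E (\<lambda>_. M)) \<Longrightarrow> \<bar>f Q\<bar> \<le> C"
  shows "(\<integral>Q. f (row_shift x y A n Q) \<partial>Pi\<^sub>M E (\<lambda>_. M)) = (\<integral>Q. f Q \<partial>Pi\<^sub>M E (\<lambda>_. M))"
  using v h f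
proof (induction n arbitrary: f)
  case (Suc n)
  let ?P = "Pi\<^sub>M E (\<lambda>_. M)"
  let ?U = "\<lambda>Q. Q(vert x y n := row_conj x y A n Q * Q (vert x y n))"
  have v: "vert x y n \<in> E" using Suc.prems(1) by simp
  have c: "row_conj x y A n \<in> ?P \<rightarrow>\<^sub>M SO_borel N"
    using Suc.prems(2) by (intro row_conj_measurable[OF M A]) auto
  have U: "?U \<in> ?P \<rightarrow>\<^sub>M ?P" "(\<integral>Q. f (?U Q) \<partial>?P) = (\<integral>Q. f Q \<partial>?P)"
    using integral_left_translate_coordinate[where A = "row_conj x y A n" and f = f and C = C, OF M E v c]
      row_conj_upd Suc.prems(3,4) by blast+
  have fU: "(\<lambda>Q. f (?U Q)) \<in> borel_measurable ?P"
    by (rule measurable_compose[OF U(1) Suc.prems(3)])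
  have bU: "\<bar>f (?U Q)\<bar> \<le> C" if "Q \<in> space ?P" for Q
    by (rule Suc.prems(4)[OF measurable_space[OF U(1) that]])
  have "(\<integral>Q. f (?U (row_shift x y A n Q)) \<partial>?P) = (\<integral>Q. f (?U Q) \<partial>?P)"
    by (rule Suc.IH[OF _ _ fU bU]) (use Suc.prems(1,2) in auto)
  also have "\<dots> = (\<integral>Q. f Q \<partial>?P)" by (rule U(2))
  finally show ?case by (simp only: row_shift.simps row_conj_row_shift)
qed simp

text \<open>In a box every square is connected to the left boundary by an unbroken row of squares,
  which the shift needs and an arbitrary exhaustion need not provide.\<close>

definition centered_box :: "nat \<Rightarrow> site set" where
  "centered_box L = {- int L..int L} \<times> {- int L..int L}"

lemma exhausting_centered_box: "exhausting centered_box"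
proof -
  have "u \<in> (\<Union>N\<in>{1..}. centered_box N)" for u :: site
  proof -
    obtain a b where u: "u = (a, b)" by (metis surj_pair)
    have "u \<in> centered_box (nat (\<bar>a\<bar> + \<bar>b\<bar>) + 1)" by (auto simp: centered_box_def u)
    then show ?thesis by auto
  qed
  then have "(\<Union>N\<in>{1..}. centered_box N) = UNIV" by blast
  moreover have "finite (centered_box N) \<and> centered_box N \<subseteq> centered_box (Suc N)" for N by (auto simp: centered_box_def)
  ultimately show ?thesis by (simp add: exhausting_def)
qed

lemma SO_config_row_shift:
  assumes Q: "SO_config N \<Lambda> Q" and A: "A \<in> carrier (SO N)"
    and h: "\<And>m. Suc m < n \<Longrightarrow> horiz x y m \<in> pos_edges_in \<Lambda>"
  shows "SO_config N \<Lambda> (row_shift x y A n Q)"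
  unfolding SO_config_def
proof
  fix e assume e: "e \<in> pos_edges_in \<Lambda>"
  show "row_shift x y A n Q e \<in> carrier (SO N)"
  proof (cases "e \<in> vert x y ` {..<n}")
    case True
    then obtain m where m: "m < n" "e = vert x y m" by auto
    have "row_conj x y A m Q \<in> carrier (SO N)"
      using Q h m(1) by (intro row_conj_SO A) (auto simp: SO_config_def)
    then show ?thesis
      using Q e m by (simp add: row_shift_vert SO_config_def SO_mult_closed)
  next
    case False
    then show ?thesis using Q e by (simp add: row_shift_other SO_config_def)
  qed
qed

locale square_in_box =
  fixes x y :: int and L :: nat
  assumes square_in: "set (unit_square x y) \<subseteq> edges_in (centered_box L)"
begin

text \<open>Counts the vertical edges with first coordinate from \<open>- int L\<close> to
  \<open>x\<close>.\<close>

abbreviation row_length :: nat where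
  "row_length \<equiv> nat (x + int L) + 1"

lemma bounds: "- int L \<le> x" "x + 1 \<le> int L" "- int L \<le> y" "y + 1 \<le> int L"
  using square_in unfolding set_unit_square_in by (auto simp: centered_box_def)

lemma vert_in: "m < row_length \<Longrightarrow> vert x y m \<in> pos_edges_in (centered_box L)"
  using bounds by (auto simp: vert_def pos_edges_in_def pos_edges_def edges_def lex_less_def centered_box_def)

lemma horiz_in: "Suc m < row_length \<Longrightarrow> horiz x y m \<in> pos_edges_in (centered_box L)"
  using bounds by (auto simp: horiz_def pos_edges_in_def pos_edges_def edges_def lex_less_def centered_box_def)

text \<open>Of the four sides only the left one is moved, at position 0 and hence by
  \<open>A\<close> itself, and it is the first factor of the product around the square.\<close>

lemma path_matrix_row_shift:
  assumes Q: "SO_config N (centered_box L) Q" and A: "A \<in> carrier (SO N)"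
  shows "path_matrix N (row_shift x y A row_length Q) (unit_square x y) = A * path_matrix N Q (unit_square x y)"
proof -
  let ?Q = "row_shift x y A row_length Q"
  have Q': "SO_config N (centered_box L) ?Q" by (rule SO_config_row_shift[OF Q A horiz_in])
  have "?Q (vert x y 0) = row_conj x y A 0 Q * Q (vert x y 0)" by (rule row_shift_vert) simp
  then have v: "?Q ((x, y), (x, y + 1)) = A * Q ((x, y), (x, y + 1))" by (simp add: vert_def del: row_shift.simps)
  have o: "?Q ((x, y + 1), (x + 1, y + 1)) = Q ((x, y + 1), (x + 1, y + 1))"
    "?Q ((x + 1, y), (x + 1, y + 1)) = Q ((x + 1, y), (x + 1, y + 1))"
    "?Q ((x, y), (x + 1, y)) = Q ((x, y), (x + 1, y))"
    by (rule row_shift_other; auto simp: vert_def)+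
  have "\<And>e. e \<in> pos_edges_in (centered_box L) \<Longrightarrow> Q e \<in> carrier_mat N N"
    using Q by (auto simp: SO_config_def dest: SO_D(1))
  then have c: "Q ((x, y), (x, y + 1)) \<in> carrier_mat N N" "Q ((x, y + 1), (x + 1, y + 1)) \<in> carrier_mat N N"
    "Q ((x + 1, y), (x + 1, y + 1)) \<in> carrier_mat N N" "Q ((x, y), (x + 1, y)) \<in> carrier_mat N N"
    using bounds by (auto simp: pos_edges_in_def pos_edges_def edges_def lex_less_def centered_box_def)
  show ?thesis
    unfolding path_matrix_unit_square[OF Q square_in] path_matrix_unit_square[OF Q' square_in] v o
    using c SO_D(1)[OF A] by (simp add: assoc_mult_mat[of _ N N _ N _ N])
qed

text \<open>A square outside the part of the row left of \<open>(x, y)\<close> has no moved edge.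
  Inside it both vertical sides move, by group elements related through the bottom edge, and the
  product around the square is conjugated up to a cyclic permutation of its factors.\<close>

lemma wilson_row_shift:
  assumes Q: "SO_config N (centered_box L) Q" and A: "A \<in> carrier (SO N)"
    and sq: "set (unit_square a b) \<subseteq> edges_in (centered_box L)" and ne: "(a, b) \<noteq> (x, y)"
  shows "wilson N (unit_square a b) (row_shift x y A row_length Q) = wilson N (unit_square a b) Q"
proof -
  let ?Q = "row_shift x y A row_length Q"
  have Q': "SO_config N (centered_box L) ?Q" by (rule SO_config_row_shift[OF Q A horiz_in])
  have ab: "- int L \<le> a" "a + 1 \<le> int L" "- int L \<le> b" "b + 1 \<le> int L"
    using sq unfolding set_unit_square_in by (auto simp: centered_box_def)
  have oh: "?Q ((a, b + 1), (a + 1, b + 1)) = Q ((a, b + 1), (a + 1, b + 1))"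
    "?Q ((a, b), (a + 1, b)) = Q ((a, b), (a + 1, b))"
    by (rule row_shift_other; auto simp: vert_def)+
  show ?thesis
  proof (cases "b = y \<and> a < x")
    case False
    have "?Q ((a, b), (a, b + 1)) = Q ((a, b), (a, b + 1))"
      "?Q ((a + 1, b), (a + 1, b + 1)) = Q ((a + 1, b), (a + 1, b + 1))"
      by (rule row_shift_other; use False ne in \<open>auto simp: vert_def\<close>)+
    then show ?thesis
      unfolding wilson_def path_matrix_unit_square[OF Q sq] path_matrix_unit_square[OF Q' sq] oh by simp
  next
    case True
    \<comment> \<open>The position of the right side of this square; its left side is at
      \<open>Suc m\<close>.\<close>
    define m where "m = nat (x - 1 - a)"
    have m: "a = x - int m - 1" "b = y" using True by (auto simp: m_def)
    have n: "Suc m < row_length" using True ab by (auto simp: m_def)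
    define C where "C = row_conj x y A m Q"
    define V H H' V1 where "V = Q ((a, b), (a, b + 1))" and "H = Q ((a, b), (a + 1, b))"
      and "H' = Q ((a, b + 1), (a + 1, b + 1))" and "V1 = Q ((a + 1, b), (a + 1, b + 1))"
    have e: "((a, b), (a, b + 1)) = vert x y (Suc m)" "((a + 1, b), (a + 1, b + 1)) = vert x y m"
      "((a, b), (a + 1, b)) = horiz x y m"
      by (auto simp: m vert_def horiz_def)
    have ov: "?Q ((a, b), (a, b + 1)) = H * C * transpose_mat H * V" "?Q ((a + 1, b), (a + 1, b + 1)) = C * V1"
      unfolding e V_def V1_def H_def C_def row_shift_vert[OF n] row_shift_vert[OF Suc_lessD[OF n]]
      by simp_all
    have SOQ: "\<And>e. e \<in> pos_edges_in (centered_box L) \<Longrightarrow> Q e \<in> carrier (SO N)"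
      using Q by (auto simp: SO_config_def)
    have so: "V \<in> carrier (SO N)" "H \<in> carrier (SO N)" "H' \<in> carrier (SO N)" "V1 \<in> carrier (SO N)"
      unfolding V_def H_def H'_def V1_def
      by (rule SOQ; use ab in \<open>auto simp: pos_edges_in_def pos_edges_def edges_def lex_less_def centered_box_def\<close>)+
    have C: "C \<in> carrier (SO N)"
      unfolding C_def using n by (intro row_conj_SO A SOQ horiz_in) auto
    note cm = so[THEN SO_D(1)] SO_D(1)[OF C]
    define Z where "Z = V * (H' * transpose_mat V1)"
    have Z: "Z \<in> carrier_mat N N" using cm by (auto simp: Z_def)
    have "path_matrix N ?Q (unit_square a b) = H * C * transpose_mat H * V * (H' * (transpose_mat (C * V1) * transpose_mat H))"
      unfolding path_matrix_unit_square[OF Q' sq] ov oh by (simp add: H_def H'_def)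
    \<comment> \<open>The left side is multiplied by \<open>C\<close> transported along
      \<open>H\<close>. Regrouped, the product around the square is the conjugate by
      \<open>H * C\<close> of the old one, read from another starting vertex.\<close>
    also have "\<dots> = (H * C) * (transpose_mat H * Z) * transpose_mat (H * C)"
      unfolding Z_def transpose_mult[OF cm(5,4)] transpose_mult[OF cm(2,5)]
      using cm by (simp add: assoc_mult_mat[of _ N N _ N _ N])
    finally have "wilson N (unit_square a b) ?Q = mat_trace (transpose_mat H * Z)"
      unfolding wilson_def using mat_trace_conj[OF SO_mult_closed[OF so(2) C], of "transpose_mat H * Z"] cm Z by simp
    also have "\<dots> = mat_trace (Z * transpose_mat H)"
      using cm Z by (intro mat_trace_comm) auto
    also have "Z * transpose_mat H = path_matrix N Q (unit_square a b)"
      unfolding path_matrix_unit_square[OF Q sq] Z_def V_def[symmetric] H_def[symmetric] H'_def[symmetric] V1_def[symmetric]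
      using cm by (simp add: assoc_mult_mat[of _ N N _ N _ N])
    finally show ?thesis by (simp only: wilson_def)
  qed
qed

end

section \<open>Gibbs expectations\<close>

text \<open>Stated for subsets because it also serves for the weight with one plaquette left
  out.\<close>

lemma plaquette_sum_bound:
  assumes Q: "SO_config N \<Lambda> Q" and S: "finite S" "S \<subseteq> pos_plaquettes_in \<Lambda>"
  shows "\<bar>c * (\<Sum>p\<in>S. wilson N p Q)\<bar> \<le> \<bar>c\<bar> * (real (card S) * real N)"
proof -
  have "\<bar>\<Sum>p\<in>S. wilson N p Q\<bar> \<le> (\<Sum>p\<in>S. \<bar>wilson N p Q\<bar>)" by (rule sum_abs)
  also have "\<dots> \<le> (\<Sum>p\<in>S. real N)"
  proof (rule sum_mono)
    fix p assume "p \<in> S"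
    then obtain a b where "p = unit_square a b" "set (unit_square a b) \<subseteq> edges_in \<Lambda>"
      using S(2) unfolding pos_plaquettes_in_eq set_unit_square_in by blast
    then show "\<bar>wilson N p Q\<bar> \<le> real N" using wilson_bound[OF Q] by simp
  qed
  finally show ?thesis by (simp add: abs_mult mult_left_mono)
qed

lemma plaquette_sum_measurable:
  assumes "haar_SO N M" "S \<subseteq> pos_plaquettes_in \<Lambda>"
  shows "(\<lambda>Q. \<Sum>p\<in>S. wilson N p Q) \<in> borel_measurable (Pi\<^sub>M (pos_edges_in \<Lambda>) (\<lambda>_. M))"
proof (rule borel_measurable_sum)
  fix p assume "p \<in> S"
  then obtain a b where "p = unit_square a b" "set (unit_square a b) \<subseteq> edges_in \<Lambda>"
    using assms(2) unfolding pos_plaquettes_in_eq set_unit_square_in by blast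
  then show "(\<lambda>Q. wilson N p Q) \<in> borel_measurable (Pi\<^sub>M (pos_edges_in \<Lambda>) (\<lambda>_. M))"
    using wilson_measurable[OF assms(1)] by simp
qed

locale gibbs_model =
  fixes H :: "nat \<Rightarrow> real mat measure" and \<Lambda> :: "site set" and N :: nat and \<beta> :: real
  assumes haar: "haar_SO N (H N)" and finite_region: "finite \<Lambda>"
begin

abbreviation "P \<equiv> product_haar H \<Lambda> N"
abbreviation "Z \<equiv> partition_function H \<Lambda> N \<beta>"

lemma prob_space_P: "prob_space P"
  unfolding product_haar_def by (rule prob_space_PiM) (rule haar_SO_D(1)[OF haar])

lemma config: "Q \<in> space P \<Longrightarrow> SO_config N \<Lambda> Q"
  unfolding product_haar_def by (rule SO_config_space[OF haar])

lemma weight_measurable: "gibbs_weight \<Lambda> N \<beta> \<in> borel_measurable P"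
  unfolding gibbs_weight_def[abs_def] product_haar_def
  using plaquette_sum_measurable[OF haar subset_refl, of \<Lambda>] by measurable

lemma weight_nonneg: "0 \<le> gibbs_weight \<Lambda> N \<beta> Q"
  by (simp add: gibbs_weight_def)

lemma weight_bounds:
  assumes "Q \<in> space P"
  shows "gibbs_weight \<Lambda> N \<beta> Q \<le> exp (\<bar>real N * \<beta>\<bar> * (real (card (pos_plaquettes_in \<Lambda>)) * real N))"
    "exp (- (\<bar>real N * \<beta>\<bar> * (real (card (pos_plaquettes_in \<Lambda>)) * real N))) \<le> gibbs_weight \<Lambda> N \<beta> Q"
  using plaquette_sum_bound[OF config[OF assms] finite_pos_plaquettes_in[OF finite_region] subset_refl, of "real N * \<beta>"]
  unfolding gibbs_weight_def by (auto simp del: abs_mult)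

lemma weight_integrable: "integrable P (gibbs_weight \<Lambda> N \<beta>)"
proof -
  interpret prob_space P by (rule prob_space_P)
  show ?thesis
    using weight_bounds(1)
    by (intro integrable_const_bound[of _ "exp (\<bar>real N * \<beta>\<bar> * (real (card (pos_plaquettes_in \<Lambda>)) * real N))"]
        weight_measurable AE_I2) (simp add: weight_nonneg)
qed

text \<open>On a finite region the weight is bounded below by a positive constant.\<close>

lemma partition_function_pos: "Z > 0"
proof -
  interpret prob_space P by (rule prob_space_P)
  let ?b = "exp (- (\<bar>real N * \<beta>\<bar> * (real (card (pos_plaquettes_in \<Lambda>)) * real N)))"
  have "(\<integral>Q. ?b \<partial>P) \<le> (\<integral>Q. gibbs_weight \<Lambda> N \<beta> Q \<partial>P)"
    using weight_bounds(2) by (intro integral_mono weight_integrable) auto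
  then have "?b \<le> Z" by (simp add: partition_function_def prob_space)
  then show ?thesis by (rule less_le_trans[rotated]) simp
qed

lemma prob_space_gibbs: "prob_space (gibbs H \<Lambda> N \<beta>)"
proof (rule prob_spaceI)
  have "emeasure (gibbs H \<Lambda> N \<beta>) (space (gibbs H \<Lambda> N \<beta>))
      = (\<integral>\<^sup>+Q. ennreal (gibbs_weight \<Lambda> N \<beta> Q / Z) * indicator (space P) Q \<partial>P)"
    unfolding gibbs_def using weight_measurable by (subst emeasure_density) auto
  also have "\<dots> = (\<integral>\<^sup>+Q. ennreal (gibbs_weight \<Lambda> N \<beta> Q / Z) \<partial>P)"
    by (intro nn_integral_cong) auto
  also have "\<dots> = ennreal (\<integral>Q. gibbs_weight \<Lambda> N \<beta> Q / Z \<partial>P)"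
    using partition_function_pos
    by (intro nn_integral_eq_integral integrable_divide_zero weight_integrable AE_I2)
      (simp add: weight_nonneg)
  also have "(\<integral>Q. gibbs_weight \<Lambda> N \<beta> Q / Z \<partial>P) = 1"
    using partition_function_pos by (simp add: partition_function_def[symmetric])
  finally show "emeasure (gibbs H \<Lambda> N \<beta>) (space (gibbs H \<Lambda> N \<beta>)) = 1" by simp
qed

lemma gibbs_simps [simp]:
  "space (gibbs H \<Lambda> N \<beta>) = space P" "sets (gibbs H \<Lambda> N \<beta>) = sets P"
  by (simp_all add: gibbs_def)

lemma expect_eq:
  assumes "F \<in> borel_measurable P"
  shows "expect H \<Lambda> N \<beta> F = (\<integral>Q. F Q * gibbs_weight \<Lambda> N \<beta> Q \<partial>P) / Z"
proof -
  have "expect H \<Lambda> N \<beta> F = (\<integral>Q. (gibbs_weight \<Lambda> N \<beta> Q / Z) *\<^sub>R F Q \<partial>P)"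
    unfolding expect_def gibbs_def
    using assms weight_measurable partition_function_pos
    by (intro integral_density AE_I2 borel_measurable_divide) (simp_all add: weight_nonneg)
  also have "\<dots> = (\<integral>Q. (F Q * gibbs_weight \<Lambda> N \<beta> Q) / Z \<partial>P)"
    by (intro Bochner_Integration.integral_cong) auto
  finally show ?thesis by simp
qed

lemma gibbs_integrable:
  fixes F :: "config \<Rightarrow> real"
  assumes "F \<in> borel_measurable P" "\<And>Q. Q \<in> space P \<Longrightarrow> \<bar>F Q\<bar> \<le> C"
  shows "integrable (gibbs H \<Lambda> N \<beta>) F"
proof -
  interpret prob_space "gibbs H \<Lambda> N \<beta>" by (rule prob_space_gibbs)
  have "F \<in> borel_measurable (gibbs H \<Lambda> N \<beta>)"
    using assms(1) by (subst measurable_cong_sets[OF gibbs_simps(2) refl])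
  then show ?thesis using assms(2) by (intro integrable_const_bound[of _ C]) auto
qed

lemma expect_bound:
  fixes F :: "config \<Rightarrow> real"
  assumes "F \<in> borel_measurable P" "\<And>Q. Q \<in> space P \<Longrightarrow> \<bar>F Q\<bar> \<le> C"
  shows "\<bar>expect H \<Lambda> N \<beta> F\<bar> \<le> C"
proof -
  interpret prob_space "gibbs H \<Lambda> N \<beta>" by (rule prob_space_gibbs)
  have "\<bar>expect H \<Lambda> N \<beta> F\<bar> \<le> (\<integral>Q. \<bar>F Q\<bar> \<partial>gibbs H \<Lambda> N \<beta>)"
    unfolding expect_def by (rule integral_abs_bound)
  also have "\<dots> \<le> (\<integral>Q. C \<partial>gibbs H \<Lambda> N \<beta>)"
    using gibbs_integrable[OF assms] assms(2) by (intro integral_mono) auto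
  finally show ?thesis using prob_space by simp
qed

lemma expect_cong:
  assumes "\<And>Q. SO_config N \<Lambda> Q \<Longrightarrow> F Q = G Q"
  shows "expect H \<Lambda> N \<beta> F = expect H \<Lambda> N \<beta> G"
  unfolding expect_def using assms config by (intro Bochner_Integration.integral_cong) auto

lemma expect_const: "expect H \<Lambda> N \<beta> (\<lambda>_. a) = a"
proof -
  interpret prob_space "gibbs H \<Lambda> N \<beta>" by (rule prob_space_gibbs)
  show ?thesis using prob_space by (simp add: expect_def)
qed

end

section \<open>Loop equations and their limit\<close>

abbreviation loop_trace :: "int \<Rightarrow> int \<Rightarrow> nat \<Rightarrow> nat \<Rightarrow> config \<Rightarrow> real" where
  "loop_trace x y N k \<equiv> wilson N (power_loop (unit_square x y) k)"

text \<open>These terms of the loop equation are of order \<open>N\<close> and disappear after division by \<open>N\<^sup>2\<close>.\<close>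

definition twisted_trace :: "int \<Rightarrow> int \<Rightarrow> nat \<Rightarrow> nat \<Rightarrow> nat \<Rightarrow> config \<Rightarrow> real" where
  "twisted_trace x y N m n Q = mat_trace (transpose_mat (path_matrix N Q (unit_square x y) ^\<^sub>m m)
     * path_matrix N Q (unit_square x y) ^\<^sub>m n)"

text \<open>The Gibbs weight splits into the factor of the chosen square and the factor
  \<open>W\<close> of all others. The row shift preserves the product measure and \<open>W\<close>
  but multiplies \<open>Y\<close> by \<open>A\<close>, which is the invariance that the abstract
  loop equation asks for; there \<open>c = real N * \<beta>\<close>.\<close>

lemma loop_equation:
  assumes haar: "haar_SO N (H N)" and sq: "set (unit_square x y) \<subseteq> edges_in (centered_box L)" and k: "k \<ge> 1"
  shows "expect H (centered_box L) N \<beta> (\<lambda>Q. (\<Sum>m<k. twisted_trace x y N m (k - m) Q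
        - loop_trace x y N m Q * loop_trace x y N (k - m) Q)
      + real N * \<beta> * (loop_trace x y N (k - 1) Q - loop_trace x y N (k + 1) Q)) = 0"
proof -
  interpret square_in_box x y L by standard fact
  have fin: "finite (centered_box L)" by (simp add: centered_box_def)
  interpret gibbs_model H "centered_box L" N \<beta> by standard fact+
  interpret P: prob_space P by (rule prob_space_P)
  let ?p = "unit_square x y"
  define Y where "Y Q = path_matrix N Q ?p" for Q
  define S where "S = pos_plaquettes_in (centered_box L) - {?p}"
  define c where "c = real N * \<beta>"
  define W where "W Q = exp (c * (\<Sum>p\<in>S. wilson N p Q))" for Q
  let ?B = "exp (\<bar>c\<bar> * (real (card S) * real N))"
  have S: "S \<subseteq> pos_plaquettes_in (centered_box L)" "finite S"
    using finite_pos_plaquettes_in[OF fin] by (auto simp: S_def)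
  have Y: "Y \<in> P \<rightarrow>\<^sub>M SO_borel N"
    unfolding Y_def[abs_def] product_haar_def by (rule path_matrix_measurable[OF haar sq])
  have Wm: "W \<in> borel_measurable P"
    unfolding W_def[abs_def] product_haar_def
    using plaquette_sum_measurable[OF haar S(1)] by measurable
  have Wb: "\<bar>W Q\<bar> \<le> ?B" if "Q \<in> space P" for Q
    using plaquette_sum_bound[OF config[OF that] S(2,1), of c] unfolding W_def by (simp del: abs_mult)
  have W: "integrable P W" using Wb Wm by (intro P.integrable_const_bound[of _ ?B]) auto
  have weight: "gibbs_weight (centered_box L) N \<beta> Q = exp (c * mat_trace (Y Q)) * W Q" for Q
  proof -
    have "?p \<in> pos_plaquettes_in (centered_box L)"
      using sq unfolding pos_plaquettes_in_eq set_unit_square_in by blast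
    then have "(\<Sum>p\<in>pos_plaquettes_in (centered_box L). wilson N p Q) = mat_trace (Y Q) + (\<Sum>p\<in>S. wilson N p Q)"
      unfolding S_def Y_def wilson_def[symmetric]
      using finite_pos_plaquettes_in[OF fin] by (rule sum.remove[rotated])
    then show ?thesis
      by (simp add: gibbs_weight_def W_def c_def distrib_left exp_add)
  qed
  have inv: "(\<integral>Q. g (A * Y Q) * W Q \<partial>P) = (\<integral>Q. g (Y Q) * W Q \<partial>P)"
    if A: "A \<in> carrier (SO N)" and g: "g \<in> borel_measurable (SO_borel N)"
      "\<And>Q. Q \<in> carrier (SO N) \<Longrightarrow> \<bar>g Q\<bar> \<le> B" for A B and g :: "real mat \<Rightarrow> real"
  proof -
    let ?T = "row_shift x y A row_length"
    have "(\<integral>Q. g (A * Y Q) * W Q \<partial>P) = (\<integral>Q. g (Y (?T Q)) * W (?T Q) \<partial>P)"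
    proof (rule Bochner_Integration.integral_cong[OF refl])
      fix Q assume "Q \<in> space P"
      then have Q: "SO_config N (centered_box L) Q" by (rule config)
      have "wilson N p (?T Q) = wilson N p Q" if p: "p \<in> S" for p
      proof -
        obtain a b where ab: "p = unit_square a b" "set (unit_square a b) \<subseteq> edges_in (centered_box L)"
          using p S(1) unfolding pos_plaquettes_in_eq set_unit_square_in by blast
        have "(a, b) \<noteq> (x, y)" using p ab(1) by (auto simp: S_def)
        then show ?thesis unfolding ab(1) by (rule wilson_row_shift[OF Q A ab(2)])
      qed
      then have "(\<Sum>p\<in>S. wilson N p (?T Q)) = (\<Sum>p\<in>S. wilson N p Q)" by (rule sum.cong[OF refl])
      then have "W (?T Q) = W Q" unfolding W_def by (rule arg_cong)
      moreover have "Y (?T Q) = A * Y Q" unfolding Y_def by (rule path_matrix_row_shift[OF Q A])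
      ultimately show "g (A * Y Q) * W Q = g (Y (?T Q)) * W (?T Q)" by (simp only:)
    qed
    also have "\<dots> = (\<integral>Q. g (Y Q) * W Q \<partial>P)"
      unfolding product_haar_def
    proof (rule integral_row_shift[where f = "\<lambda>Q. g (Y Q) * W Q" and C = "B * ?B",
          OF haar A finite_pos_edges_in[OF fin] vert_in horiz_in])
      show "(\<lambda>Q. g (Y Q) * W Q) \<in> borel_measurable (Pi\<^sub>M (pos_edges_in (centered_box L)) (\<lambda>_. H N))"
        using measurable_compose[OF Y g(1)] Wm unfolding product_haar_def by simp
      show "\<bar>g (Y Q) * W Q\<bar> \<le> B * ?B" if "Q \<in> space (Pi\<^sub>M (pos_edges_in (centered_box L)) (\<lambda>_. H N))" for Q
      proof -
        have Q: "Q \<in> space P" using that by (simp add: product_haar_def)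
        have "\<bar>g (Y Q)\<bar> \<le> B" using measurable_space[OF Y Q] g(2) by simp
        then show ?thesis
          unfolding abs_mult using Wb[OF Q] by (intro mult_mono) auto
      qed
    qed
    finally show ?thesis .
  qed
  let ?G = "\<lambda>Q. (\<Sum>m<k. twisted_trace x y N m (k - m) Q
        - loop_trace x y N m Q * loop_trace x y N (k - m) Q)
      + real N * \<beta> * (loop_trace x y N (k - 1) Q - loop_trace x y N (k + 1) Q)"
  let ?F = "\<lambda>Q. ((\<Sum>m<k. mat_trace (transpose_mat (Y Q ^\<^sub>m m) * Y Q ^\<^sub>m (k - m))
        - mat_trace (Y Q ^\<^sub>m m) * mat_trace (Y Q ^\<^sub>m (k - m)))
      + c * (mat_trace (Y Q ^\<^sub>m (k - 1)) - mat_trace (Y Q ^\<^sub>m (k + 1))))"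
  have GF: "?G Q = ?F Q" if "SO_config N (centered_box L) Q" for Q
    unfolding twisted_trace_def wilson_def path_matrix_power_loop[OF that sq] Y_def c_def ..
  have Fm: "?F \<in> borel_measurable P"
    by (intro borel_measurable_add borel_measurable_sum borel_measurable_diff borel_measurable_times
        borel_measurable_const measurable_mat_trace[where N = N] measurable_SO_mult measurable_SO_transpose measurable_SO_pow Y)
  have "expect H (centered_box L) N \<beta> ?G = expect H (centered_box L) N \<beta> ?F"
    by (rule expect_cong) (rule GF)
  also have "\<dots> = (\<integral>Q. ?F Q * gibbs_weight (centered_box L) N \<beta> Q \<partial>P) / Z" by (rule expect_eq[OF Fm])
  also have "(\<integral>Q. ?F Q * gibbs_weight (centered_box L) N \<beta> Q \<partial>P) = 0"
  proof -
    have "?F Q * gibbs_weight (centered_box L) N \<beta> Q = ?F Q * exp (c * mat_trace (Y Q)) * W Q" for Q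
      unfolding weight by (rule mult.assoc[symmetric])
    then have "(\<integral>Q. ?F Q * gibbs_weight (centered_box L) N \<beta> Q \<partial>P) = (\<integral>Q. ?F Q * exp (c * mat_trace (Y Q)) * W Q \<partial>P)"
      by (simp only:)
    also have "\<dots> = 0"
      by (rule loop_equation_of_invariance[OF W Y _ k]) (rule inv)
    finally show ?thesis .
  qed
  finally show ?thesis by simp
qed

lemma mat_trace_one: "mat_trace (1\<^sub>m N) = real N"
  by (simp add: mat_trace_def)

lemma loop_trace_0: "loop_trace x y N 0 = (\<lambda>_. real N)"
  by (rule ext) (simp add: wilson_def power_loop_def mat_trace_one)

text \<open>All terms are bounded, hence integrable, so the expectation may be taken term by term. A
  twisted trace is the trace of a single element of SO(N), which gives the second claim.\<close>

lemma loop_equation_expanded: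
  assumes haar: "haar_SO N (H N)" and sq: "set (unit_square x y) \<subseteq> edges_in (centered_box L)" and k: "k \<ge> 1"
  shows "(\<Sum>m<k. expect H (centered_box L) N \<beta> (twisted_trace x y N m (k - m))
        - expect H (centered_box L) N \<beta> (\<lambda>Q. loop_trace x y N m Q * loop_trace x y N (k - m) Q))
      + real N * \<beta> * (expect H (centered_box L) N \<beta> (loop_trace x y N (k - 1))
        - expect H (centered_box L) N \<beta> (loop_trace x y N (k + 1))) = 0"
    and "\<bar>expect H (centered_box L) N \<beta> (twisted_trace x y N m n)\<bar> \<le> real N"
proof -
  have fin: "finite (centered_box L)" by (simp add: centered_box_def)
  interpret gibbs_model H "centered_box L" N \<beta> by standard fact+
  let ?G = "gibbs H (centered_box L) N \<beta>"
  have p: "path_matrix N Q (unit_square x y) \<in> carrier (SO N)" if "Q \<in> space P" for Q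
    by (rule path_matrix_SO[OF config[OF that] sq])
  have pm: "(\<lambda>Q. path_matrix N Q (unit_square x y)) \<in> P \<rightarrow>\<^sub>M SO_borel N"
    unfolding product_haar_def by (rule path_matrix_measurable[OF haar sq])
  have tm: "twisted_trace x y N m n \<in> borel_measurable P" for m n
    unfolding twisted_trace_def[abs_def]
    by (intro measurable_mat_trace[where N = N] measurable_SO_mult measurable_SO_transpose measurable_SO_pow pm)
  have tb: "\<bar>twisted_trace x y N m n Q\<bar> \<le> real N" if "Q \<in> space P" for m n Q
    unfolding twisted_trace_def using p[OF that]
    by (intro mat_trace_bound SO_mult_closed SO_transpose_closed SO_pow_closed)
  have sub: "set (power_loop (unit_square x y) m) \<subseteq> edges_in (centered_box L)" for m
    using set_power_loop sq by blast
  have lm: "loop_trace x y N m \<in> borel_measurable P" for m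
    unfolding product_haar_def by (rule wilson_measurable[OF haar sub])
  have lb: "\<bar>loop_trace x y N m Q\<bar> \<le> real N" if "Q \<in> space P" for m Q
    by (rule wilson_bound[OF config[OF that] sub])
  have i1: "integrable ?G (twisted_trace x y N m n)" for m n
    by (rule gibbs_integrable[OF tm tb])
  have i2: "integrable ?G (loop_trace x y N m)" for m
    by (rule gibbs_integrable[OF lm lb])
  have i3: "integrable ?G (\<lambda>Q. loop_trace x y N m Q * loop_trace x y N n Q)" for m n
  proof (rule gibbs_integrable)
    show "(\<lambda>Q. loop_trace x y N m Q * loop_trace x y N n Q) \<in> borel_measurable P"
      by (intro borel_measurable_times lm)
    show "\<bar>loop_trace x y N m Q * loop_trace x y N n Q\<bar> \<le> real N * real N" if "Q \<in> space P" for Q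
      unfolding abs_mult using lb[OF that] by (intro mult_mono) auto
  qed
  have i4: "integrable ?G (\<lambda>Q. \<Sum>m<k. twisted_trace x y N m (k - m) Q - loop_trace x y N m Q * loop_trace x y N (k - m) Q)"
    by (intro Bochner_Integration.integrable_sum Bochner_Integration.integrable_diff i1 i3)
  have i5: "integrable ?G (\<lambda>Q. real N * \<beta> * (loop_trace x y N (k - 1) Q - loop_trace x y N (k + 1) Q))"
    by (intro integrable_mult_right Bochner_Integration.integrable_diff i2)
  show "(\<Sum>m<k. expect H (centered_box L) N \<beta> (twisted_trace x y N m (k - m))
        - expect H (centered_box L) N \<beta> (\<lambda>Q. loop_trace x y N m Q * loop_trace x y N (k - m) Q))
      + real N * \<beta> * (expect H (centered_box L) N \<beta> (loop_trace x y N (k - 1))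
        - expect H (centered_box L) N \<beta> (loop_trace x y N (k + 1))) = 0"
    using loop_equation[where H = H and N = N and \<beta> = \<beta>, OF haar sq k]
    by (simp only: expect_def Bochner_Integration.integral_add[OF i4 i5] integral_mult_right_zero
        Bochner_Integration.integral_sum[OF Bochner_Integration.integrable_diff[OF i1 i3]]
        Bochner_Integration.integral_diff[OF i1 i3] Bochner_Integration.integral_diff[OF i2 i2])
  show "\<bar>expect H (centered_box L) N \<beta> (twisted_trace x y N m n)\<bar> \<le> real N"
    by (rule expect_bound[OF tm tb])
qed

lemma eventually_square_in_centered_box:
  "\<forall>\<^sub>F N in sequentially. N \<ge> 1 \<and> set (unit_square x y) \<subseteq> edges_in (centered_box N)"
  unfolding set_unit_square_in
  \<comment> \<open>The added 1 makes room for the coordinates \<open>x + 1\<close> and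
    \<open>y + 1\<close> and ensures \<open>N \<ge> 1\<close>.\<close>
  by (rule eventually_sequentiallyI[of "nat (\<bar>x\<bar> + \<bar>y\<bar>) + 1"]) (auto simp: centered_box_def)

text \<open>The power 0 is the empty walk, which is not a loop, so \<open>strong_coupling\<close>
  says nothing about it. The value 1 is the normalized trace of the identity.\<close>

definition loop_moment :: "(nat \<Rightarrow> real mat measure) \<Rightarrow> int \<Rightarrow> int \<Rightarrow> nat \<Rightarrow> real \<Rightarrow> real" where
  "loop_moment H x y k \<beta> = (if k = 0 then 1 else wilson_limit H centered_box (power_loop (unit_square x y) k) \<beta>)"

lemma loop_moment_recursion:
  assumes haar: "\<And>N. N \<ge> 1 \<Longrightarrow> haar_SO N (H N)"
    and sc: "strong_coupling H \<beta>\<^sub>0" and \<beta>: "\<bar>\<beta>\<bar> < \<beta>\<^sub>0" and k: "k \<ge> 1"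
  shows "(\<Sum>m<k. loop_moment H x y m \<beta> * loop_moment H x y (k - m) \<beta>)
      = \<beta> * (loop_moment H x y (k - 1) \<beta> - loop_moment H x y (k + 1) \<beta>)"
proof -
  let ?e = "\<lambda>N. expect H (centered_box N) N \<beta>"
  let ?w = "\<lambda>m. loop_moment H x y m \<beta>"
  have loops: "is_loop (power_loop (unit_square x y) m)" if "m \<ge> 1" for m
    by (rule is_loop_power_loop[OF unit_square_is_loop(1) that])
  have fact: "(\<lambda>N. ?e N (\<lambda>Q. \<Prod>l\<leftarrow>ls. wilson N l Q) / real N ^ length ls)
      \<longlonglongrightarrow> (\<Prod>l\<leftarrow>ls. wilson_limit H centered_box l \<beta>)" if "\<forall>l\<in>set ls. is_loop l" for ls
    using sc \<beta> exhausting_centered_box that by (simp add: strong_coupling_def)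
  have ev0: "\<forall>\<^sub>F N in sequentially. ?e N (loop_trace x y N 0) = real N"
    using eventually_ge_at_top[of 1]
  proof eventually_elim
    case (elim N)
    interpret gibbs_model H "centered_box N" N \<beta>
      by standard (use haar elim in \<open>auto simp: centered_box_def\<close>)
    show ?case unfolding loop_trace_0 by (rule expect_const)
  qed
  have single: "(\<lambda>N. ?e N (loop_trace x y N m) / real N) \<longlonglongrightarrow> ?w m" for m
  proof (cases "m = 0")
    case True
    have "\<forall>\<^sub>F N in sequentially. 1 = ?e N (loop_trace x y N m) / real N"
      using ev0 eventually_ge_at_top[of 1] by eventually_elim (simp add: True)
    then have "(\<lambda>N. ?e N (loop_trace x y N m) / real N) \<longlonglongrightarrow> 1"
      by (rule Lim_transform_eventually[OF tendsto_const])
    then show ?thesis by (simp add: loop_moment_def True)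
  next
    \<comment> \<open>Factorization for a list with one loop is plain convergence to the
      limit.\<close>
    case False
    then show ?thesis
      using fact[of "[power_loop (unit_square x y) m]"] loops[of m] by (simp add: loop_moment_def)
  qed
  have pair: "(\<lambda>N. ?e N (\<lambda>Q. loop_trace x y N m Q * loop_trace x y N (k - m) Q) / (real N)\<^sup>2) \<longlonglongrightarrow> ?w m * ?w (k - m)"
    if "m < k" for m
  proof (cases "m = 0")
    case True
    have "?e N (loop_trace x y N k) / real N = ?e N (\<lambda>Q. loop_trace x y N m Q * loop_trace x y N (k - m) Q) / (real N)\<^sup>2" for N
      by (simp add: True loop_trace_0 expect_def power2_eq_square)
    then show ?thesis using single[of k] by (simp add: True loop_moment_def[of _ _ _ 0])
  next
    case False
    then show ?thesis
      using fact[of "[power_loop (unit_square x y) m, power_loop (unit_square x y) (k - m)]"]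
        loops[of m] loops[of "k - m"] that by (simp add: loop_moment_def power2_eq_square)
  qed
  have twisted: "(\<lambda>N. ?e N (twisted_trace x y N m (k - m)) / (real N)\<^sup>2) \<longlonglongrightarrow> 0" for m
  proof (rule Lim_null_comparison)
    show "\<forall>\<^sub>F N in sequentially. norm (?e N (twisted_trace x y N m (k - m)) / (real N)\<^sup>2) \<le> 1 / real N"
      using eventually_square_in_centered_box[of x y]
    proof eventually_elim
      case (elim N)
      then have "\<bar>?e N (twisted_trace x y N m (k - m))\<bar> \<le> real N"
        using loop_equation_expanded(2)[where H = H and N = N, OF haar _ k] by blast
      then have "\<bar>?e N (twisted_trace x y N m (k - m))\<bar> / (real N)\<^sup>2 \<le> real N / (real N)\<^sup>2"
        by (rule divide_right_mono) simp
      then show ?case using elim by (simp add: power2_eq_square)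
    qed
    show "(\<lambda>N. 1 / real N) \<longlonglongrightarrow> 0" by (rule lim_1_over_n)
  qed
  \<comment> \<open>The expanded loop equation divided by \<open>N\<^sup>2\<close>: in the term with
    \<beta> one factor N cancels and the other normalizes the single trace.\<close>
  let ?t = "\<lambda>N. (\<Sum>m<k. ?e N (twisted_trace x y N m (k - m)) / (real N)\<^sup>2
        - ?e N (\<lambda>Q. loop_trace x y N m Q * loop_trace x y N (k - m) Q) / (real N)\<^sup>2)
      + \<beta> * (?e N (loop_trace x y N (k - 1)) / real N - ?e N (loop_trace x y N (k + 1)) / real N)"
  have "?t \<longlonglongrightarrow> (\<Sum>m<k. 0 - ?w m * ?w (k - m)) + \<beta> * (?w (k - 1) - ?w (k + 1))"
    by (intro tendsto_intros twisted pair single) auto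
  moreover have "?t \<longlonglongrightarrow> 0"
  proof (rule Lim_transform_eventually[OF tendsto_const])
    show "\<forall>\<^sub>F N in sequentially. 0 = ?t N"
      using eventually_square_in_centered_box[of x y]
    proof eventually_elim
      case (elim N)
      let ?S = "\<Sum>m<k. ?e N (twisted_trace x y N m (k - m))
        - ?e N (\<lambda>Q. loop_trace x y N m Q * loop_trace x y N (k - m) Q)"
      let ?R = "?e N (loop_trace x y N (k - 1)) - ?e N (loop_trace x y N (k + 1))"
      have "?t N = ?S / (real N)\<^sup>2 + \<beta> * (?R / real N)"
        by (simp only: diff_divide_distrib sum_divide_distrib)
      also have "\<dots> = (?S + real N * \<beta> * ?R) / (real N)\<^sup>2"
        using elim by (simp add: add_divide_distrib power2_eq_square)
      also have "\<dots> = 0"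
        using loop_equation_expanded(1)[where H = H and N = N and L = N and \<beta> = \<beta>, OF haar _ k] elim by simp
      finally show ?case by (rule sym)
    qed
  qed
  ultimately have "(\<Sum>m<k. 0 - ?w m * ?w (k - m)) + \<beta> * (?w (k - 1) - ?w (k + 1)) = 0"
    by (rule LIMSEQ_unique)
  then show ?thesis by (simp add: sum_negf)
qed

theorem theorem2p7:
  fixes H :: "nat \<Rightarrow> real mat measure"
    and \<beta>\<^sub>0 \<beta> :: real
    and \<Lambda> :: "nat \<Rightarrow> site set"
    and p :: "edge list"
  assumes "\<And>N. N \<ge> 1 \<Longrightarrow> haar_SO N (H N)"
    and "exhausting \<Lambda>"
    and "strong_coupling H \<beta>\<^sub>0"
    and "\<bar>\<beta>\<bar> < \<beta>\<^sub>0"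
    and "plaquette p"
  shows "(\<lambda>N. expect H (\<Lambda> N) N \<beta> (wilson N p) / real N) \<longlonglongrightarrow> \<beta> \<and> wilson_limit H \<Lambda> p \<beta> = \<beta>"
proof -
  obtain x y where p: "is_loop p"
    and w: "\<And>N \<Lambda> Q. SO_config N \<Lambda> Q \<Longrightarrow> set (unit_square x y) \<subseteq> edges_in \<Lambda> \<Longrightarrow>
      wilson N p Q = wilson N (unit_square x y) Q"
    using wilson_plaquette[OF assms(5)] by blast
  \<comment> \<open>The recursion enters for every coupling in the interval, not only for the given
    one, since coefficients of power series are compared.\<close>
  have "loop_moment H x y 1 \<beta> = \<beta>"
  proof (rule loop_recursion_solution[where w = "loop_moment H x y" and r = \<beta>\<^sub>0])
    show "\<beta>\<^sub>0 > 0" using assms(3) by (simp add: strong_coupling_def)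
    show "loop_moment H x y 0 t = 1" for t by (simp add: loop_moment_def)
    show "\<exists>F. fps_represents \<beta>\<^sub>0 F (loop_moment H x y k)" if k: "k \<ge> 1" for k
    proof -
      have "is_loop (power_loop (unit_square x y) k)"
        by (rule is_loop_power_loop[OF unit_square_is_loop(1) k])
      \<comment> \<open>One coefficient sequence serves all couplings, by the order of quantifiers
        in \<open>strong_coupling\<close>.\<close>
      then obtain a :: "nat \<Rightarrow> real" where a: "\<And>t. \<bar>t\<bar> < \<beta>\<^sub>0 \<Longrightarrow> summable (\<lambda>n. \<bar>a n * t ^ n\<bar>) \<and>
          wilson_limit H centered_box (power_loop (unit_square x y) k) t = (\<Sum>n. a n * t ^ n)"
        using assms(3) exhausting_centered_box unfolding strong_coupling_def by meson
      have "fps_represents \<beta>\<^sub>0 (Abs_fps a) (loop_moment H x y k)"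
        unfolding fps_represents_def
      proof (intro allI impI)
        fix t assume t: "\<bar>t\<bar> < \<beta>\<^sub>0"
        have s: "summable (\<lambda>n. \<bar>a n * t ^ n\<bar>)" using a[OF t] by blast
        then have "(\<lambda>n. a n * t ^ n) sums loop_moment H x y k t"
          using a[OF t] k summable_rabs_cancel[OF s] by (simp add: loop_moment_def sums_iff)
        with s show "summable (\<lambda>n. \<bar>fps_nth (Abs_fps a) n * t ^ n\<bar>) \<and>
            (\<lambda>n. fps_nth (Abs_fps a) n * t ^ n) sums loop_moment H x y k t"
          by simp
      qed
      then show ?thesis ..
    qed
    show "(\<Sum>j<k. loop_moment H x y j t * loop_moment H x y (k - j) t)
        = t * (loop_moment H x y (k - 1) t - loop_moment H x y (k + 1) t)" if "k \<ge> 1" "\<bar>t\<bar> < \<beta>\<^sub>0" for k t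
      using loop_moment_recursion[OF assms(1,3) that(2,1)] .
  qed (rule assms(4))
  then have sq: "wilson_limit H centered_box (unit_square x y) \<beta> = \<beta>"
    by (simp add: loop_moment_def power_loop_def)
  have conv: "(\<lambda>N. expect H (L N) N \<beta> (wilson N l) / real N) \<longlonglongrightarrow> wilson_limit H L l \<beta>"
    if "exhausting L" "is_loop l" for L l
  proof -
    have "convergent (\<lambda>N. expect H (L N) N \<beta> (wilson N l) / real N)"
      using assms(3,4) that by (simp add: strong_coupling_def)
    then show ?thesis unfolding wilson_limit_def by (rule convergent_LIMSEQ_iff[THEN iffD1])
  qed
  \<comment> \<open>\<open>p\<close> and the square may differ as lists; their Wilson variables
    agree as soon as the box contains the square, which suffices for the limits.\<close>
  have "\<forall>\<^sub>F N in sequentially. expect H (centered_box N) N \<beta> (wilson N (unit_square x y)) / real N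
      = expect H (centered_box N) N \<beta> (wilson N p) / real N"
    using eventually_square_in_centered_box[of x y]
  proof eventually_elim
    case (elim N)
    interpret gibbs_model H "centered_box N" N \<beta>
      by standard (use assms(1) elim in \<open>auto simp: centered_box_def\<close>)
    have "expect H (centered_box N) N \<beta> (wilson N p) = expect H (centered_box N) N \<beta> (wilson N (unit_square x y))"
      using w elim by (intro expect_cong) blast
    then show ?case by simp
  qed
  then have "(\<lambda>N. expect H (centered_box N) N \<beta> (wilson N p) / real N) \<longlonglongrightarrow> \<beta>"
    by (rule Lim_transform_eventually[OF conv[OF exhausting_centered_box unit_square_is_loop(1), of x y, unfolded sq]])
  then have "wilson_limit H centered_box p \<beta> = \<beta>"
    using conv[OF exhausting_centered_box p] LIMSEQ_unique by blast
  moreover have "wilson_limit H \<Lambda> p \<beta> = wilson_limit H centered_box p \<beta>"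
    using assms(2-4) exhausting_centered_box p unfolding strong_coupling_def by meson
  ultimately show ?thesis using conv[OF assms(2) p] by simp
qed

end
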